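(* Let $(X,f)$ be a dynamical system with the shadowing property, let $Y\subset X$ be a chain recurrent class and let $\Phi\in\mathcal{C}(X,\mathbb{R})$ be a continuous observable. Suppose there exist ergodic measures $\mu_1,\mu_2\in\mathcal{M}_e(Y)$ such that $$\int\Phi\,d\mu_1\neq\int\Phi\,d\mu_2 .$$ Then for every $\varepsilon>0$ the set $Z_\varepsilon:=I_{\Phi}(f)\cap B(Y,\varepsilon)\cap CR(f)$ is nonempty and the following lower bounds hold: (a) $h_{Z_\varepsilon}(f)\geq h_Y(f)$; (b) $\overline{\mathrm{mdim}}_{Z_\varepsilon}(f)\geq\overline{\mathrm{mdim}}_Y(f)$; (c) $\underline{\mathrm{mdim}}_{Z_\varepsilon}(f)\geq\underline{\mathrm{mdim}}_Y(f)$.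
   Context: A dynamical system $(X,f)$ is a compact metric space $(X,d)$ together with a continuous map $f:X\to X$. $\mathcal{C}(X,\mathbb{R})$ is the set of continuous functions $X\to\mathbb{R}$. For $Z\subset X$ and $\varepsilon>0$, $B(Z,\varepsilon)$ denotes the $\varepsilon$-neighborhood of $Z$ with respect to $d$. Shadowing: for $\delta>0$, a sequence $\{x_n\}_{n\ge 0}\subset X$ is a $\delta$-pseudo-orbit if $d(f(x_n),x_{n+1})<\delta$ for all $n\ge 0$. The map $f$ has the shadowing property if for every $\varepsilon>0$ there is $\delta>0$ such that for every $\delta$-pseudo-orbit $\{x_n\}_{n\ge0}$ there is $y\in X$ with $d(x_n,f^n(y))<\varepsilon$ for all $n\ge 0$. Chain recurrence: $x$ is in the chain stable set of $y$ if for every $\varepsilon>0$ there are points $x_0=x,x_1,\dots,x_n=y$ in $X$ (with $n\ge1$) and a nondecreasing sequence of positive integers $t_0,\dots,t_{n-1}$ such that $d(f^{t_i}(x_i),x_{i+1})<\varepsilon$ for $i=0,\dots,n-1$. Points $x,y$ are chain related if each is in the chain stable set of the other. $CR(f)$, the set of chain recurrent points, is the set of all $x\in X$ chain related to themselves; the chain relation is an equivalence relation on $CR(f)$ and its equivalence classes are called chain recurrent classes. Each chain recurrent class is closed and $f$-invariant. $\mathcal{M}_e(Y)$ is the set of ergodic $f$-invariant Borel probability measures on $Y$ (for $f|_Y$). Irregular set: $I_{\Phi}(f)$ is the set of $x\in X$ for which the sequence $\frac1n\sum_{i=0}^{n-1}\Phi(f^i(x))$ does not converge as $n\to\infty$.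 Bowen entropy: let $d_n(x,y)=\max\{d(f^i(x),f^i(y)):0\le i\le n-1\}$ and $B_n(x,\varepsilon)=\{y\in X:d_n(x,y)<\varepsilon\}$. For $Z\subset X$ (not necessarily compact or invariant), let $\mathcal{G}_n(Z,\varepsilon)$ be the collection of all finite or countable coverings of $Z$ by Bowen balls $B_v(x,\varepsilon)$ with $x\in X$ and integers $v\ge n$. Put $$C(Z,t,n,\varepsilon,f)=\inf_{C\in\mathcal{G}_n(Z,\varepsilon)}\sum_{B_v(x,\varepsilon)\in C}e^{-tv},\qquad C(Z,t,\varepsilon,f)=\lim_{n\to\infty}C(Z,t,n,\varepsilon,f),$$ $$h_Z(f,\varepsilon)=\inf\{t:C(Z,t,\varepsilon,f)=0\}=\sup\{t:C(Z,t,\varepsilon,f)=\infty\}.$$ The (Bowen) topological entropy of $Z$ is $h_Z(f)=\lim_{\varepsilon\to0}h_Z(f,\varepsilon)\in[0,\infty]$. The upper and lower relative metric mean dimension of $Z$ are $$\overline{\mathrm{mdim}}_Z(f)=\limsup_{\theta\to0}\frac{h_Z(f,\theta)}{-\log\theta},\qquad \underline{\mathrm{mdim}}_Z(f)=\liminf_{\theta\to0}\frac{h_Z(f,\theta)}{-\log\theta}.$$ *)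

theory Defs
  imports "HOL-Probability.Probability"
begin

text \<open>A dynamical system is a map \<open>f\<close> on a type of class \<open>metric_space\<close>; compactness of
  the whole space and continuity of \<open>f\<close> are explicit hypotheses where they are used.\<close>

definition pseudo_orbit :: "('a::metric_space \<Rightarrow> 'a) \<Rightarrow> real \<Rightarrow> (nat \<Rightarrow> 'a) \<Rightarrow> bool" where
  "pseudo_orbit f \<delta> x \<longleftrightarrow> (\<forall>n. dist (f (x n)) (x (Suc n)) < \<delta>)"

definition shadowing_property :: "('a::metric_space \<Rightarrow> 'a) \<Rightarrow> bool" where
  "shadowing_property f \<longleftrightarrow>
     (\<forall>\<epsilon>>0. \<exists>\<delta>>0. \<forall>x. pseudo_orbit f \<delta> x \<longrightarrow> (\<exists>y. \<forall>n. dist (x n) ((f ^^ n) y) < \<epsilon>))"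

definition chain_stable_set :: "('a::metric_space \<Rightarrow> 'a) \<Rightarrow> 'a \<Rightarrow> 'a set" where
  "chain_stable_set f y =
     {x. \<forall>\<epsilon>>0. \<exists>n\<ge>1. \<exists>(p :: nat \<Rightarrow> 'a) (t :: nat \<Rightarrow> nat).
        p 0 = x \<and> p n = y \<and> (\<forall>i<n. t i > 0) \<and> mono_on {..<n} t \<and>
        (\<forall>i<n. dist ((f ^^ t i) (p i)) (p (Suc i)) < \<epsilon>)}"

definition chain_related :: "('a::metric_space \<Rightarrow> 'a) \<Rightarrow> 'a \<Rightarrow> 'a \<Rightarrow> bool" where
  "chain_related f x y \<longleftrightarrow> x \<in> chain_stable_set f y \<and> y \<in> chain_stable_set f x"

definition chain_recurrent_set :: "('a::metric_space \<Rightarrow> 'a) \<Rightarrow> 'a set" where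
  "chain_recurrent_set f = {x. chain_related f x x}"

definition chain_recurrent_classes :: "('a::metric_space \<Rightarrow> 'a) \<Rightarrow> 'a set set" where
  "chain_recurrent_classes f =
     chain_recurrent_set f //
       {(x, y). x \<in> chain_recurrent_set f \<and> y \<in> chain_recurrent_set f \<and> chain_related f x y}"

text \<open>Measures on \<open>Y\<close> have \<open>Y\<close> itself as underlying space and the trace of the Borel sets as
  \<open>\<sigma>\<close>-algebra. The measurability condition makes \<open>distr \<mu> \<mu> f\<close> meaningful and forces
  \<open>f\<close> to map \<open>Y\<close> into \<open>Y\<close>; it is automatic for continuous \<open>f\<close> and forward invariant \<open>Y\<close>.\<close>

definition ergodic_measures :: "('a::metric_space \<Rightarrow> 'a) \<Rightarrow> 'a set \<Rightarrow> 'a measure set" where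
  "ergodic_measures f Y =
     {\<mu>. prob_space \<mu> \<and> space \<mu> = Y \<and> sets \<mu> = sets (restrict_space borel Y) \<and>
         f \<in> measurable \<mu> \<mu> \<and> distr \<mu> \<mu> f = \<mu> \<and>
         (\<forall>A\<in>sets \<mu>. f -` A \<inter> Y = A \<longrightarrow> measure \<mu> A = 0 \<or> measure \<mu> A = 1)}"

definition irregular_set :: "('a \<Rightarrow> real) \<Rightarrow> ('a \<Rightarrow> 'a) \<Rightarrow> 'a set" where
  "irregular_set \<Phi> f = {x. \<not> convergent (\<lambda>n. (1 / real n) * (\<Sum>i<n. \<Phi> ((f ^^ i) x)))}"

definition set_nbhd :: "'a::metric_space set \<Rightarrow> real \<Rightarrow> 'a set" where
  "set_nbhd Z \<epsilon> = (\<Union>z\<in>Z. ball z \<epsilon>)"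

text \<open>\<open>bowen_dist f n\<close> is only meaningful for \<open>n \<ge> 1\<close>. The unspecified case \<open>n = 0\<close> affects
  \<open>bowen_outer\<close> below only at \<open>n = 0\<close>, hence not its limit.\<close>

definition bowen_dist :: "('a::metric_space \<Rightarrow> 'a) \<Rightarrow> nat \<Rightarrow> 'a \<Rightarrow> 'a \<Rightarrow> real" where
  "bowen_dist f n x y = Max ((\<lambda>i. dist ((f ^^ i) x) ((f ^^ i) y)) ` {..<n})"

definition bowen_ball :: "('a::metric_space \<Rightarrow> 'a) \<Rightarrow> nat \<Rightarrow> 'a \<Rightarrow> real \<Rightarrow> 'a set" where
  "bowen_ball f n x \<epsilon> = {y. bowen_dist f n x y < \<epsilon>}"

text \<open>A covering by Bowen balls is recorded as the set of its labels \<open>(x, v)\<close>, since a ball as a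
  set does not determine the length \<open>v\<close> that enters the weight \<open>exp (- t * v)\<close>.\<close>

definition bowen_covers ::
  "('a::metric_space \<Rightarrow> 'a) \<Rightarrow> 'a set \<Rightarrow> nat \<Rightarrow> real \<Rightarrow> ('a \<times> nat) set set" where
  "bowen_covers f Z n \<epsilon> =
     {C. countable C \<and> (\<forall>(x, v)\<in>C. v \<ge> n) \<and> Z \<subseteq> (\<Union>(x, v)\<in>C. bowen_ball f v x \<epsilon>)}"

definition bowen_outer ::
  "('a::metric_space \<Rightarrow> 'a) \<Rightarrow> 'a set \<Rightarrow> real \<Rightarrow> nat \<Rightarrow> real \<Rightarrow> ennreal" where
  "bowen_outer f Z t n \<epsilon> =
     (INF C\<in>bowen_covers f Z n \<epsilon>. \<Sum>\<^sub>\<infinity>(x, v)\<in>C. ennreal (exp (- t * real v)))"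

definition bowen_outer_lim ::
  "('a::metric_space \<Rightarrow> 'a) \<Rightarrow> 'a set \<Rightarrow> real \<Rightarrow> real \<Rightarrow> ennreal" where
  "bowen_outer_lim f Z t \<epsilon> = lim (\<lambda>n. bowen_outer f Z t n \<epsilon>)"

text \<open>The critical exponent is taken over all real \<open>t\<close>; it is nonnegative for nonempty \<open>Z\<close>
  (and \<open>-\<infinity>\<close> for empty \<open>Z\<close>).\<close>

definition bowen_entropy_at :: "('a::metric_space \<Rightarrow> 'a) \<Rightarrow> 'a set \<Rightarrow> real \<Rightarrow> ereal" where
  "bowen_entropy_at f Z \<epsilon> = Inf {ereal t | t. bowen_outer_lim f Z t \<epsilon> = 0}"

definition bowen_entropy :: "('a::metric_space \<Rightarrow> 'a) \<Rightarrow> 'a set \<Rightarrow> ereal" where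
  "bowen_entropy f Z = Lim (at_right 0) (\<lambda>\<epsilon>. bowen_entropy_at f Z \<epsilon>)"

definition upper_mdim :: "('a::metric_space \<Rightarrow> 'a) \<Rightarrow> 'a set \<Rightarrow> ereal" where
  "upper_mdim f Z = Limsup (at_right 0) (\<lambda>\<theta>. bowen_entropy_at f Z \<theta> / ereal (- ln \<theta>))"

definition lower_mdim :: "('a::metric_space \<Rightarrow> 'a) \<Rightarrow> 'a set \<Rightarrow> ereal" where
  "lower_mdim f Z = Liminf (at_right 0) (\<lambda>\<theta>. bowen_entropy_at f Z \<theta> / ereal (- ln \<theta>))"

end

theory Submission
  imports Defs
begin

text \<open>Write \<open>h\<^sub>Z(\<theta>)\<close> for the Bowen entropy of \<open>Z\<close> at scale \<open>\<theta>\<close>. All three inequalities follow from the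
  single estimate \<open>h\<^sub>Y(3\<theta>) \<le> h\<^sub>Z(\<theta>)\<close>, valid for every \<open>\<theta> > 0\<close>
  (\<open>irregular_entropy_at_ge\<close>): the entropy is the supremum over the scales, and the factor 3
  disappears in the quotient by \<open>- ln \<theta>\<close> as \<open>\<theta>\<close> tends to 0. Nonemptiness of \<open>Z\<close> comes out of
  the same construction. As \<open>Z\<close> does not depend on \<open>\<theta>\<close>, the construction may be repeated with new
  parameters for each scale.

  Fix \<open>t < t' < h\<^sub>Y(3\<theta>)\<close>. If \<open>Y\<close> could be covered by fewer than \<open>exp (n t')\<close> Bowen balls of length
  \<open>n\<close> for infinitely many \<open>n\<close>, these covers would force \<open>h\<^sub>Y(3\<theta>) \<le> t'\<close>; hence for all large \<open>n\<close>
  the set \<open>Y\<close> contains at least \<open>exp (n t')\<close> points that are \<open>3\<theta>\<close>-separated up to time \<open>n\<close>.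
  Chain transitivity of \<open>Y\<close> turns the orbit segment of each such point into a loop, that is, a finite
  pseudo-orbit that starts at a base point \<open>p\<close> of \<open>Y\<close> and can be followed by \<open>p\<close> again. The
  connecting pieces have a length bounded independently of \<open>n\<close>, so after discarding all but a fixed
  fraction of the points all these loops have one length and contain the orbit segment at one
  position. Each block of a pseudo-orbit is one such free loop followed by a control
  loop, which is one of two loops of equal length along which \<open>\<Phi>\<close> has clearly different
  averages. The control loop takes only a small fixed share of the block, so that the number of free
  choices per unit of time still exceeds \<open>exp t\<close>.

  Three points carry the construction.

  \<^item> Control loops: an invariant measure \<open>\<mu>\<close> on \<open>Y\<close> has, for every \<open>n\<close>, a point of \<open>Y\<close> whose
    average of \<open>\<Phi>\<close> up to time \<open>n\<close> is at least \<open>\<integral>\<Phi> d\<mu>\<close>, since the integral of the averages is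
    \<open>\<integral>\<Phi> d\<mu>\<close> (\<open>invariant_measure_orbit_sum_ge\<close>).

  \<^item> Irregularity: for a given sequence of free loops, compare the pseudo-orbit that always uses the
    low control loop with the one whose control loops alternate on exponentially growing stretches of
    time. The free parts cancel in the difference of the two averages, and what is left oscillates. So
    the averages along at least one of the two shadowing points diverge, whatever the free
    loops are (\<open>irregular_by_comparison\<close>).

  \<^item> Chain recurrence: a shadowing point need not be chain recurrent, but the pseudo-orbits in question
    return to \<open>p\<close> infinitely often. Closing them up at such a time gives periodic
    pseudo-orbits; the orbit of a point that shadows a periodic one comes back close to itself while
    still shadowing it. A limit of such points is chain recurrent and shadows the original
    pseudo-orbit (\<open>recurrent_pseudo_orbit_shadowed_in_chain_recurrent_set\<close>).

  Thus every sequence of free loops is followed by some point of \<open>Z\<close>. A Bowen ball of length \<open>v\<close> and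
  radius \<open>\<theta>\<close> can contain such points only for sequences that agree on the blocks completed before
  time \<open>v\<close>. A cover of \<open>Z\<close> by Bowen balls therefore induces a cover of a full shift by
  cylinders, whose total uniform product measure is at least 1, and this bounds the weight of the
  cover from below (\<open>entropy_distribution_principle\<close>).\<close>

section \<open>Pseudo-orbit paths and loops in a chain recurrent class\<close>

text \<open>The endpoint \<open>b\<close> is not a member of the list. Paths then compose by
  concatenating lists, and powers of a loop are pseudo-orbit paths again.\<close>

definition pseudo_path :: "('a::metric_space \<Rightarrow> 'a) \<Rightarrow> real \<Rightarrow> 'a \<Rightarrow> 'a list \<Rightarrow> 'a \<Rightarrow> bool" where
  "pseudo_path f \<delta> a xs b \<longleftrightarrow>
     xs \<noteq> [] \<and> hd xs = a \<and> successively (\<lambda>u v. dist (f u) v < \<delta>) (xs @ [b])"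

abbreviation orbit_segment :: "('a \<Rightarrow> 'a) \<Rightarrow> 'a \<Rightarrow> nat \<Rightarrow> 'a list" where
  "orbit_segment f u n \<equiv> map (\<lambda>i. (f ^^ i) u) [0..<n]"

lemma pseudo_path_append:
  assumes "pseudo_path f \<delta> a xs b" "pseudo_path f \<delta> b ys c"
  shows "pseudo_path f \<delta> a (xs @ ys) c"
  using assms unfolding pseudo_path_def
  by (auto simp: successively_append_iff hd_append)

lemma pseudo_path_replicate:
  assumes "pseudo_path f \<delta> p xs p" "k > 0"
  shows "pseudo_path f \<delta> p (concat (replicate k xs)) p"
  using \<open>k > 0\<close>
proof (induction k)
  case (Suc k)
  then show ?case
    using assms(1) pseudo_path_append[OF assms(1)] by (cases "k = 0") auto
qed simp

lemma pseudo_path_orbit_segment: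
  assumes "\<delta> > 0" "n > 0" "dist ((f ^^ n) u) b < \<delta>"
  shows "pseudo_path f \<delta> u (orbit_segment f u n) b"
proof -
  have "successively (\<lambda>u v. dist (f u) v < \<delta>) (orbit_segment f u n @ [b])"
    if "n > 0" "dist ((f ^^ n) u) b < \<delta>" for n b
    using that
  proof (induction n arbitrary: b)
    case (Suc n)
    show ?case
    proof (cases "n = 0")
      case False
      have "successively (\<lambda>u v. dist (f u) v < \<delta>) (orbit_segment f u n @ [(f ^^ n) u])"
        using Suc.IH False \<open>\<delta> > 0\<close> by simp
      then show ?thesis
        using Suc.prems by (auto simp: successively_append_iff)
    qed (use Suc.prems in auto)
  qed simp
  then show ?thesis
    using assms by (auto simp: pseudo_path_def hd_map)
qed

lemma pseudo_path_perturb_end: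
  assumes "pseudo_path f \<delta> a xs q" "dist q u < \<delta>'"
  shows "pseudo_path f (\<delta> + \<delta>') a xs u"
proof -
  have *: "\<delta>' > 0" using assms(2) by (meson dist_not_less_zero not_le_imp_less order_le_less_trans zero_le_dist)
  have "successively (\<lambda>u v. dist (f u) v < \<delta> + \<delta>') xs"
  proof (rule successively_mono)
    show "successively (\<lambda>u v. dist (f u) v < \<delta>) xs"
      using assms(1) by (simp add: pseudo_path_def successively_append_iff)
  qed (use * in auto)
  moreover have "dist (f (last xs)) u < \<delta> + \<delta>'"
    using assms dist_triangle[of "f (last xs)" u q]
    by (auto simp: pseudo_path_def successively_append_iff)
  ultimately show ?thesis
    using assms(1) by (auto simp: pseudo_path_def successively_append_iff)
qed

text \<open>Each jump along \<open>t i\<close> iterates is spelled out as an orbit segment. This removes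
  the monotonicity condition on the times, under which chains could not be concatenated.\<close>

lemma chain_stable_set_pseudo_path:
  assumes "x \<in> chain_stable_set f y" "\<delta> > 0"
  obtains xs where "pseudo_path f \<delta> x xs y"
proof -
  obtain n p t where n: "n \<ge> 1" and p: "p 0 = x" "p n = y" and t: "\<forall>i<n. t i > (0::nat)"
    and step: "\<forall>i<n. dist ((f ^^ t i) (p i)) (p (Suc i)) < \<delta>"
    using assms unfolding chain_stable_set_def by blast
  have "\<exists>xs. pseudo_path f \<delta> (p 0) xs (p (Suc j))" if "j < n" for j
    using that
  proof (induction j)
    case 0
    then show ?case using pseudo_path_orbit_segment[OF \<open>\<delta> > 0\<close>] t step by blast
  next
    case (Suc j)
    then obtain xs where "pseudo_path f \<delta> (p 0) xs (p (Suc j))" by auto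
    moreover have "pseudo_path f \<delta> (p (Suc j)) (orbit_segment f (p (Suc j)) (t (Suc j))) (p (Suc (Suc j)))"
      using pseudo_path_orbit_segment[OF \<open>\<delta> > 0\<close>] t step Suc.prems by blast
    ultimately show ?case using pseudo_path_append by blast
  qed
  from this[of "n - 1"] show ?thesis using n p that by auto
qed

lemma chain_recurrent_class_base_point:
  assumes "Y \<in> chain_recurrent_classes f"
  obtains p where "p \<in> Y" "\<And>u. u \<in> Y \<Longrightarrow> chain_related f p u"
  using assms unfolding chain_recurrent_classes_def chain_recurrent_set_def
  by (auto elim!: quotientE)

text \<open>A finite net of \<open>Y\<close> suffices: a path to a net point is redirected to a nearby
  point by perturbing its last step, and a path from a net point can be entered from nearby. The net
  is taken inside \<open>Y\<close>, where the chain relation to \<open>p\<close> is known.\<close>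

lemma uniform_connecting_length:
  fixes f :: "'a::metric_space \<Rightarrow> 'a"
  assumes "compact (UNIV :: 'a set)" "\<delta> > 0"
    and rel: "\<And>u. u \<in> Y \<Longrightarrow> chain_related f p u"
  obtains T where "\<And>u. u \<in> Y \<Longrightarrow> \<exists>xs. length xs \<le> T \<and> pseudo_path f \<delta> p xs u"
    and "\<And>u. u \<in> Y \<Longrightarrow> \<exists>q xs. length xs \<le> T \<and> dist u q < \<delta> \<and> pseudo_path f \<delta> q xs p"
proof -
  have cl: "compact (closure Y)"
    using assms(1) closed_closure compact_Int_closed by (metis inf_top.left_neutral)
  have cover: "closure Y \<subseteq> (\<Union>y\<in>Y. ball y (\<delta>/2))"
  proof
    fix x assume "x \<in> closure Y"
    then obtain y where "y \<in> Y" "dist y x < \<delta>/2"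
      using \<open>\<delta> > 0\<close> unfolding closure_approachable by (meson half_gt_zero)
    then show "x \<in> (\<Union>y\<in>Y. ball y (\<delta>/2))" by auto
  qed
  obtain A where A: "A \<subseteq> Y" "finite A" "closure Y \<subseteq> (\<Union>y\<in>A. ball y (\<delta>/2))"
    using compactE_image[OF cl _ cover] by (metis open_ball)
  have "\<exists>xs. pseudo_path f (\<delta>/2) p xs q" "\<exists>xs. pseudo_path f \<delta> q xs p" if "q \<in> A" for q
  proof -
    have "p \<in> chain_stable_set f q" "q \<in> chain_stable_set f p"
      using rel[of q] that A(1) by (auto simp: chain_related_def)
    moreover have "\<delta>/2 > 0" using \<open>\<delta> > 0\<close> by simp
    ultimately show "\<exists>xs. pseudo_path f (\<delta>/2) p xs q" "\<exists>xs. pseudo_path f \<delta> q xs p"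
      using chain_stable_set_pseudo_path \<open>\<delta> > 0\<close> by metis+
  qed
  then obtain X Z where X: "\<And>q. q \<in> A \<Longrightarrow> pseudo_path f (\<delta>/2) p (X q) q"
    and Z: "\<And>q. q \<in> A \<Longrightarrow> pseudo_path f \<delta> q (Z q) p" by metis
  define T where "T = (\<Sum>q\<in>A. length (X q) + length (Z q))"
  have T: "length (X q) + length (Z q) \<le> T" if "q \<in> A" for q
    unfolding T_def using A(2) that by (intro member_le_sum) auto
  show ?thesis
  proof (rule that)
    fix u assume "u \<in> Y"
    then obtain q where q: "q \<in> A" "dist q u < \<delta>/2"
      using A(3) closure_subset[of Y] by (auto simp: subset_iff)
    have "pseudo_path f \<delta> p (X q) u" 
      using pseudo_path_perturb_end[OF X[OF q(1)] q(2)] by simp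
    then show "\<exists>xs. length xs \<le> T \<and> pseudo_path f \<delta> p xs u"
      using T[OF q(1)] by (intro exI[of _ "X q"]) auto
    show "\<exists>q xs. length xs \<le> T \<and> dist u q < \<delta> \<and> pseudo_path f \<delta> q xs p"
      using T[OF q(1)] Z[OF q(1)] q(2) \<open>\<delta> > 0\<close>
      by (intro exI[of _ q] exI[of _ "Z q"]) (auto simp: dist_commute)
  qed
qed

text \<open>The bound \<open>T\<close> depends on \<open>\<delta>\<close> but not on the length \<open>n\<close> of the segment, so the
  connecting pieces become negligible for long segments.\<close>

lemma loop_through_orbit_segment:
  fixes f :: "'a::metric_space \<Rightarrow> 'a"
  assumes "compact (UNIV :: 'a set)" "\<delta> > 0"
    and rel: "\<And>u. u \<in> Y \<Longrightarrow> chain_related f p u"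
    and inv: "f ` Y \<subseteq> Y"
  obtains T where "\<And>u n. u \<in> Y \<Longrightarrow> n > 0 \<Longrightarrow> \<exists>xs ys. length xs \<le> T \<and> length ys \<le> T \<and>
      pseudo_path f \<delta> p (xs @ orbit_segment f u n @ ys) p"
proof -
  obtain T where T1: "\<And>u. u \<in> Y \<Longrightarrow> \<exists>xs. length xs \<le> T \<and> pseudo_path f \<delta> p xs u"
    and T2: "\<And>u. u \<in> Y \<Longrightarrow> \<exists>q xs. length xs \<le> T \<and> dist u q < \<delta> \<and> pseudo_path f \<delta> q xs p"
    using uniform_connecting_length[OF assms(1-3)] by blast
  have iter: "(f ^^ n) u \<in> Y" if "u \<in> Y" for u n
    using that inv by (induction n) auto
  show ?thesis
  proof (rule that)
    fix u and n :: nat assume u: "u \<in> Y" "n > 0"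
    obtain xs where xs: "length xs \<le> T" "pseudo_path f \<delta> p xs u" using T1 u by blast
    obtain q ys where ys: "length ys \<le> T" "dist ((f ^^ n) u) q < \<delta>" "pseudo_path f \<delta> q ys p"
      using T2 iter u(1) by blast
    have "pseudo_path f \<delta> p (xs @ orbit_segment f u n @ ys) p"
      using xs(2) pseudo_path_orbit_segment[OF \<open>\<delta> > 0\<close> u(2) ys(2)] ys(3) pseudo_path_append by metis
    then show "\<exists>xs ys. length xs \<le> T \<and> length ys \<le> T \<and>
      pseudo_path f \<delta> p (xs @ orbit_segment f u n @ ys) p" using xs ys by blast
  qed
qed

section \<open>Chain recurrent points that shadow\<close>

text \<open>The chain goes from \<open>z\<close> to \<open>f w\<close> in one step and then along the orbit of \<open>w\<close> back
  to \<open>z\<close>. The bound \<open>m \<ge> 2\<close> makes the second time positive.\<close>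

lemma chain_recurrent_if_approx_returning:
  fixes f :: "'a::metric_space \<Rightarrow> 'a"
  assumes cont: "continuous_on UNIV f"
    and ret: "\<And>e. e > 0 \<Longrightarrow> \<exists>w m. m \<ge> 2 \<and> dist z w < e \<and> dist ((f ^^ m) w) z < e"
  shows "z \<in> chain_recurrent_set f"
proof -
  have "z \<in> chain_stable_set f z"
    unfolding chain_stable_set_def
  proof (intro CollectI allI impI)
    fix e :: real assume "e > 0"
    obtain d where d: "d > 0" "\<And>w. dist w z < d \<Longrightarrow> dist (f w) (f z) < e"
      using cont \<open>e > 0\<close> unfolding continuous_on_iff by (metis UNIV_I)
    obtain w m where w: "m \<ge> 2" "dist z w < min d e" "dist ((f ^^ m) w) z < min d e"
      using ret[of "min d e"] d(1) \<open>e > 0\<close> by auto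
    define q where "q = (\<lambda>i::nat. if i = 1 then f w else z)"
    define t where "t = (\<lambda>i::nat. if i = 0 then 1 else m - 1)"
    have "(f ^^ (m - 1)) (f w) = (f ^^ m) w"
      using w(1) by (metis Suc_diff_1 funpow_Suc_right o_apply less_le_trans pos2)
    then have "\<forall>i<2. dist ((f ^^ t i) (q i)) (q (Suc i)) < e"
      using w d(2)[of w] by (auto simp: t_def q_def less_2_cases_iff dist_commute)
    moreover have "\<forall>i<2. t i > 0" "mono_on {..<2} t"
      using w(1) by (auto simp: t_def mono_on_def)
    ultimately show "\<exists>n\<ge>1. \<exists>p t. p 0 = z \<and> p n = z \<and> (\<forall>i<n. 0 < t i) \<and> mono_on {..<n} t \<and>
        (\<forall>i<n. dist ((f ^^ t i) (p i)) (p (Suc i)) < e)"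
      by (intro exI[of _ 2] conjI exI[of _ q] exI[of _ t]) (auto simp: q_def)
  qed
  then show ?thesis by (simp add: chain_recurrent_set_def chain_related_def)
qed

lemma continuous_on_funpow:
  fixes f :: "'a::topological_space \<Rightarrow> 'a"
  assumes "continuous_on UNIV f"
  shows "continuous_on UNIV (f ^^ n)"
proof (induction n)
  case (Suc n)
  then show ?case
    using continuous_on_compose[OF Suc continuous_on_subset[OF assms subset_UNIV]] by simp
qed (simp add: id_def)

text \<open>If \<open>y\<close> shadows the periodic extension of \<open>s 0, \<dots>, s (P - 1)\<close>, then so do all points
  \<open>(f ^^ (a * P)) y\<close>. By compactness two of these are close to each other, and the earlier one is \<open>w\<close>.\<close>

lemma periodic_pseudo_orbit_shadowed_by_returning_point:
  fixes f :: "'a::metric_space \<Rightarrow> 'a"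
  assumes cpt: "compact (UNIV :: 'a set)"
    and shad: "\<And>x. pseudo_orbit f \<delta> x \<Longrightarrow> \<exists>y. \<forall>n. dist (x n) ((f ^^ n) y) < e"
    and po: "pseudo_orbit f \<delta> s" and per: "s P = s 0" "P > 0" and "r > 0"
  obtains w m where "m \<ge> P" "dist ((f ^^ m) w) w < r" "\<And>i. i < P \<Longrightarrow> dist (s i) ((f ^^ i) w) < e"
proof -
  have "pseudo_orbit f \<delta> (\<lambda>i. s (i mod P))"
    using po per unfolding pseudo_orbit_def by (auto simp: mod_Suc) metis+
  then obtain y where y: "\<And>n. dist (s (n mod P)) ((f ^^ n) y) < e" using shad by blast
  have "seq_compact (UNIV :: 'a set)" using cpt compact_eq_seq_compact_metric by blast
  then obtain l r' where r': "strict_mono (r' :: nat \<Rightarrow> nat)" "((\<lambda>a. (f ^^ (a * P)) y) \<circ> r') \<longlonglongrightarrow> l"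
    unfolding seq_compact_def by blast
  then have "Cauchy ((\<lambda>a. (f ^^ (a * P)) y) \<circ> r')" by (metis LIMSEQ_imp_Cauchy)
  then obtain n where n: "dist ((f ^^ (r' (Suc n) * P)) y) ((f ^^ (r' n * P)) y) < r"
    using \<open>r > 0\<close> unfolding Cauchy_def by (metis le_SucI o_apply order_refl)
  define a where "a = r' n"
  define b where "b = r' (Suc n)"
  have ab: "a < b" using r'(1) by (simp add: a_def b_def strict_mono_Suc_iff)
  show ?thesis
  proof (rule that)
    show "P \<le> (b - a) * P" using ab by (cases "b - a") auto
    have "(f ^^ ((b - a) * P)) ((f ^^ (a * P)) y) = (f ^^ (b * P)) y"
      using ab by (metis add_mult_distrib comp_apply funpow_add le_add_diff_inverse2 less_imp_le_nat)
    then show "dist ((f ^^ ((b - a) * P)) ((f ^^ (a * P)) y)) ((f ^^ (a * P)) y) < r"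
      using n by (simp add: a_def b_def)
    fix i assume "i < P"
    then show "dist (s i) ((f ^^ i) ((f ^^ (a * P)) y)) < e"
      using y[of "i + a * P"] by (simp add: funpow_add)
  qed
qed

text \<open>The point \<open>z\<close> is a limit of points that shadow longer and longer initial pieces
  of \<open>s\<close> and return ever closer to themselves; the strict shadowing bound becomes weak in the
  limit.\<close>

lemma recurrent_pseudo_orbit_shadowed_in_chain_recurrent_set:
  fixes f :: "'a::metric_space \<Rightarrow> 'a"
  assumes cpt: "compact (UNIV :: 'a set)" and cont: "continuous_on UNIV f"
    and shad: "\<And>x. pseudo_orbit f \<delta> x \<Longrightarrow> \<exists>y. \<forall>n. dist (x n) ((f ^^ n) y) < e"
    and po: "pseudo_orbit f \<delta> s" and ret: "\<And>k. s (k * L) = s 0" and "L > 0"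
  obtains z where "z \<in> chain_recurrent_set f" "\<And>n. dist (s n) ((f ^^ n) z) \<le> e"
proof -
  have "\<exists>w m. m \<ge> (k + 2) * L \<and> dist ((f ^^ m) w) w < 1 / real (Suc k) \<and>
      (\<forall>i < (k + 2) * L. dist (s i) ((f ^^ i) w) < e)" for k
    using periodic_pseudo_orbit_shadowed_by_returning_point[OF cpt shad po ret, of "k + 2" "1 / real (Suc k)"]
      \<open>L > 0\<close> by (metis add_is_0 divide_pos_pos mult_pos_pos neq0_conv of_nat_0_less_iff zero_less_Suc
        zero_less_one zero_neq_numeral)
  then obtain w m where m: "\<And>k. m k \<ge> (k + 2) * L"
    and wm: "\<And>k. dist ((f ^^ m k) (w k)) (w k) < 1 / real (Suc k)"
    and w: "\<And>k i. i < (k + 2) * L \<Longrightarrow> dist (s i) ((f ^^ i) (w k)) < e"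
    by metis
  have "seq_compact (UNIV :: 'a set)" using cpt compact_eq_seq_compact_metric by blast
  then obtain z r where r: "strict_mono (r :: nat \<Rightarrow> nat)" "(w \<circ> r) \<longlonglongrightarrow> z"
    unfolding seq_compact_def by blast
  show ?thesis
  proof (rule that)
    show "z \<in> chain_recurrent_set f"
    proof (rule chain_recurrent_if_approx_returning[OF cont])
      fix d :: real assume "d > 0"
      have "eventually (\<lambda>j. dist (w (r j)) z < d/2) sequentially"
        using tendstoD[OF r(2), of "d/2"] \<open>d > 0\<close> by simp
      moreover have "eventually (\<lambda>j. 1 / real (Suc (r j)) < d/2) sequentially"
        using order_tendstoD(2)[OF LIMSEQ_inverse_real_of_nat, of "d/2"] \<open>d > 0\<close>
          filterlim_subseq[OF r(1)]
        by (auto simp: inverse_eq_divide filterlim_iff)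
      ultimately have "eventually (\<lambda>j. dist (w (r j)) z < d/2 \<and> 1 / real (Suc (r j)) < d/2) sequentially"
        by (rule eventually_conj)
      then obtain j where j: "dist (w (r j)) z < d/2" "1 / real (Suc (r j)) < d/2"
        using eventually_happens' trivial_limit_sequentially by blast
      have "2 \<le> m (r j)" using m[of "r j"] \<open>L > 0\<close>
        by (metis Suc_leI le_add2 le_trans mult.commute mult_le_mono nat_mult_1 One_nat_def)
      moreover have "dist ((f ^^ m (r j)) (w (r j))) z < d"
        using wm[of "r j"] j dist_triangle[of "(f ^^ m (r j)) (w (r j))" z "w (r j)"] by linarith
      moreover have "dist z (w (r j)) < d" using j(1) \<open>d > 0\<close> by (simp add: dist_commute)
      ultimately show "\<exists>w m. 2 \<le> m \<and> dist z w < d \<and> dist ((f ^^ m) w) z < d" by blast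
    qed
    fix n
    have "isCont (f ^^ n) z"
      using continuous_on_funpow[OF cont] by (simp add: continuous_on_eq_continuous_at)
    then have "(\<lambda>j. (f ^^ n) (w (r j))) \<longlonglongrightarrow> (f ^^ n) z"
      using r(2) by (auto intro: isCont_tendsto_compose simp: o_def)
    then have lim: "(\<lambda>j. dist (s n) ((f ^^ n) (w (r j)))) \<longlonglongrightarrow> dist (s n) ((f ^^ n) z)"
      by (intro tendsto_intros)
    have le: "dist (s n) ((f ^^ n) (w (r j))) \<le> e" if "j \<ge> n" for j
    proof -
      have "n < r j + 2" using seq_suble[OF r(1), of j] that by simp
      also have "\<dots> \<le> (r j + 2) * L" using \<open>L > 0\<close> by (cases L) auto
      finally have "n < (r j + 2) * L" .
      then show ?thesis using w less_imp_le by blast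
    qed
    show "dist (s n) ((f ^^ n) z) \<le> e"
      using le by (intro Lim_bounded[OF lim, of n]) simp
  qed
qed

section \<open>Sequences of blocks and irregularity by comparison\<close>

definition block_sequence :: "nat \<Rightarrow> (nat \<Rightarrow> 'a list) \<Rightarrow> nat \<Rightarrow> 'a" where
  "block_sequence L W i = W (i div L) ! (i mod L)"

lemma block_sequence_nth:
  assumes "i < L"
  shows "block_sequence L W (b * L + i) = W b ! i"
  using assms by (simp add: block_sequence_def div_add1_eq)

lemma pseudo_orbit_block_sequence:
  assumes "L > 0" and len: "\<And>b. length (W b) = L" and loop: "\<And>b. pseudo_path f \<delta> p (W b) p"
  shows "pseudo_orbit f \<delta> (block_sequence L W)"
  unfolding pseudo_orbit_def
proof
  fix n
  define b i where "b = n div L" and "i = n mod L"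
  have i: "i < L" and n: "n = b * L + i" using \<open>L > 0\<close> by (auto simp: b_def i_def)
  have step: "dist (f ((W b @ [p]) ! i)) ((W b @ [p]) ! Suc i) < \<delta>"
    using loop[of b] i len[of b] by (auto simp: pseudo_path_def successively_conv_nth)
  have W0: "W c ! 0 = p" for c
    using loop[of c] by (auto simp: pseudo_path_def hd_conv_nth)
  show "dist (f (block_sequence L W n)) (block_sequence L W (Suc n)) < \<delta>"
  proof (cases "Suc i < L")
    case True
    have "block_sequence L W n = W b ! i" "block_sequence L W (Suc n) = W b ! Suc i"
      using block_sequence_nth[OF i, of W b] block_sequence_nth[OF True, of W b] n by simp_all
    then show ?thesis
      using step True i len[of b] by (simp add: nth_append)
  next
    case False
    then have "Suc i = L" using i by simp
    then have "Suc n = Suc b * L + 0" using n by simp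
    then have "block_sequence L W (Suc n) = p" 
      using block_sequence_nth[OF \<open>L > 0\<close>] W0 by metis
    then show ?thesis
      using step \<open>Suc i = L\<close> i len[of b] n block_sequence_nth[OF i, of W b] by (simp add: nth_append)
  qed
qed

lemma sum_block_sequence:
  fixes \<Phi> :: "'a \<Rightarrow> real"
  assumes "\<And>b. length (W b) = L"
  shows "(\<Sum>i<k * L. \<Phi> (block_sequence L W i)) = (\<Sum>b<k. sum_list (map \<Phi> (W b)))"
proof -
  have "(\<Sum>i = b * L..<b * L + L. \<Phi> (block_sequence L W i)) = sum_list (map \<Phi> (W b))" for b
  proof -
    have "(\<Sum>i = b * L..<b * L + L. \<Phi> (block_sequence L W i)) 
        = (\<Sum>i = 0..<L. \<Phi> (block_sequence L W (b * L + i)))"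
      using sum.shift_bounds_nat_ivl[of "\<lambda>i. \<Phi> (block_sequence L W i)" 0 "b * L" L] 
      by (simp add: add.commute)
    also have "\<dots> = (\<Sum>i = 0..<L. \<Phi> (W b ! i))" by (simp add: block_sequence_nth)
    also have "\<dots> = sum_list (map \<Phi> (W b))" 
      by (simp add: sum_list_sum_nth assms)
    finally show ?thesis .
  qed
  then show ?thesis by (simp add: sum.nat_group[symmetric])
qed

text \<open>Among the first \<open>4\<^sup>j\<^sup>+\<^sup>1\<close> numbers the last three quarters behave alike, so the
  proportion of oscillating numbers is at least 3/4 or at most 1/4 according to the parity of
  \<open>j\<close>.\<close>

definition oscillating :: "nat \<Rightarrow> bool" where
  "oscillating b \<longleftrightarrow> (\<exists>j. odd j \<and> 4 ^ j \<le> b \<and> b < 4 ^ Suc j)"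

lemma card_oscillating_ge:
  assumes "odd j"
  shows "3 * 4 ^ j \<le> card {b. b < 4 ^ Suc j \<and> oscillating b}"
proof -
  have "{4 ^ j..<4 ^ Suc j} \<subseteq> {b. b < 4 ^ Suc j \<and> oscillating b}"
    using assms by (auto simp: oscillating_def)
  then have "card {4 ^ j..<4 ^ Suc j :: nat} \<le> card {b. b < 4 ^ Suc j \<and> oscillating b}"
    by (intro card_mono) auto
  then show ?thesis by simp
qed

lemma card_oscillating_le:
  assumes "even j"
  shows "card {b. b < 4 ^ Suc j \<and> oscillating b} \<le> 4 ^ j"
proof -
  have "b < 4 ^ j" if b: "b < 4 ^ Suc j" and osc: "oscillating b" for b :: nat
  proof (rule ccontr)
    assume "\<not> b < 4 ^ j"
    obtain i where i: "odd i" "4 ^ i \<le> b" "b < 4 ^ Suc i" using osc oscillating_def by blast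
    have "(4::nat) ^ i < 4 ^ Suc j" "(4::nat) ^ j < 4 ^ Suc i" 
      using i b \<open>\<not> b < 4 ^ j\<close> by linarith+
    then have "i < Suc j" "j < Suc i" 
      by (simp_all only: power_strict_increasing_iff[of "4::nat"])
    then have "i = j" by simp
    then show False using i assms by simp
  qed
  then have "card {b. b < 4 ^ Suc j \<and> oscillating b} \<le> card {..<4 ^ j :: nat}"
    by (intro card_mono) auto
  then show ?thesis by simp
qed

text \<open>If both averages converged, so would their difference. But up to an error of
  \<open>2 \<eta>\<close> this difference is \<open>D / L\<close> times the proportion of oscillating blocks, which keeps
  jumping between values of at least 3/4 and at most 1/4. The condition on \<open>D\<close> says that the
  resulting gap \<open>D / (2 L)\<close> exceeds the two errors together.\<close>

lemma irregular_by_comparison: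
  fixes \<Phi> :: "'a \<Rightarrow> real" and a a' :: "nat \<Rightarrow> real"
  assumes a: "\<And>i. \<bar>\<Phi> ((f ^^ i) z) - a i\<bar> \<le> \<eta>" and a': "\<And>i. \<bar>\<Phi> ((f ^^ i) z') - a' i\<bar> \<le> \<eta>"
    and "L > 0"
    and diff: "\<And>k. (\<Sum>i<k * L. a' i - a i) = D * real (card {b. b < k \<and> oscillating b})"
    and D: "D > 8 * \<eta> * real L"
  shows "z \<in> irregular_set \<Phi> f \<or> z' \<in> irregular_set \<Phi> f"
proof (rule ccontr)
  assume regular: "\<not> ?thesis"
  define u where "u = (\<lambda>n. (1 / real n) * (\<Sum>i<n. \<Phi> ((f ^^ i) z')) - (1 / real n) * (\<Sum>i<n. \<Phi> ((f ^^ i) z)))"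
  have "convergent u"
    using regular unfolding u_def irregular_set_def by (auto intro!: convergent_diff)
  then have "Cauchy u" by (rule convergent_Cauchy)
  moreover have gap: "D / (2 * real L) - 4 * \<eta> > 0" using D \<open>L > 0\<close> by (simp add: field_simps)
  ultimately obtain J where J: "\<And>m n. m \<ge> J \<Longrightarrow> n \<ge> J \<Longrightarrow> \<bar>u m - u n\<bar> < D / (2 * real L) - 4 * \<eta>"
    unfolding Cauchy_def by (metis dist_real_def)
  have approx: "\<bar>u (k * L) - D / real L * (real (card {b. b < k \<and> oscillating b}) / real k)\<bar> \<le> 2 * \<eta>"
    if "k > 0" for k
  proof -
    define n where "n = k * L"
    have n: "n > 0" using that \<open>L > 0\<close> by (simp add: n_def)
    have "u n - (1 / real n) * (\<Sum>i<n. a' i - a i)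
        = (1 / real n) * (\<Sum>i<n. (\<Phi> ((f ^^ i) z') - a' i) - (\<Phi> ((f ^^ i) z) - a i))"
      by (simp add: u_def sum_subtractf right_diff_distrib)
    moreover have "\<bar>\<Sum>i<n. (\<Phi> ((f ^^ i) z') - a' i) - (\<Phi> ((f ^^ i) z) - a i)\<bar> \<le> real n * (2 * \<eta>)"
    proof -
      have "\<bar>(\<Phi> ((f ^^ i) z') - a' i) - (\<Phi> ((f ^^ i) z) - a i)\<bar> \<le> 2 * \<eta>" for i
        using a[of i] a'[of i] by linarith
      then have "(\<Sum>i<n. \<bar>(\<Phi> ((f ^^ i) z') - a' i) - (\<Phi> ((f ^^ i) z) - a i)\<bar>) \<le> real (card {..<n}) * (2 * \<eta>)"
        by (intro sum_bounded_above)
      then show ?thesis using order_trans[OF sum_abs] by simp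
    qed
    ultimately have "\<bar>u n - (1 / real n) * (\<Sum>i<n. a' i - a i)\<bar> \<le> 2 * \<eta>"
      using n by (simp add: abs_mult pos_divide_le_eq mult.commute)
    moreover have "(1 / real n) * (\<Sum>i<n. a' i - a i) = D / real L * (real (card {b. b < k \<and> oscillating b}) / real k)"
      unfolding n_def diff by simp
    ultimately show ?thesis by (simp only: n_def)
  qed
  \<comment> \<open>an even index followed by an odd one, both beyond the Cauchy threshold \<open>J\<close>\<close>
  define j where "j = 2 * J"
  have large: "4 ^ Suc i * L \<ge> J" if "i \<ge> J" for i
  proof -
    have "J \<le> Suc i" using that by simp
    also have "\<dots> \<le> 4 ^ Suc i" using less_exp[of "Suc i"] power_mono[of 2 "4::nat" "Suc i"] by linarith
    also have "\<dots> \<le> 4 ^ Suc i * L" using \<open>L > 0\<close> by simp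
    finally show ?thesis .
  qed
  have Dpos: "D / real L > 0"
  proof -
    have "8 * \<eta> * real L \<ge> 0" using a[of 0] by simp
    then show ?thesis using D \<open>L > 0\<close> by simp
  qed
  have "real (card {b. b < 4 ^ Suc j \<and> oscillating b}) \<le> real (4 ^ j)"
    using card_oscillating_le[of j] by (simp only: of_nat_le_iff) (simp add: j_def)
  then have lo: "real (card {b. b < 4 ^ Suc j \<and> oscillating b}) / real (4 ^ Suc j) \<le> 1/4"
    by (simp add: field_simps)
  have "real (3 * 4 ^ Suc j) \<le> real (card {b. b < 4 ^ Suc (Suc j) \<and> oscillating b})"
    using card_oscillating_ge[of "Suc j"] by (simp only: of_nat_le_iff) (simp add: j_def)
  then have hi: "real (card {b. b < 4 ^ Suc (Suc j) \<and> oscillating b}) / real (4 ^ Suc (Suc j)) \<ge> 3/4"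
    by (simp add: field_simps)
  have "D / real L * (3/4) - D / real L * (1/4) \<le> \<bar>u (4 ^ Suc (Suc j) * L) - u (4 ^ Suc j * L)\<bar> + 4 * \<eta>"
    using approx[of "4 ^ Suc j"] approx[of "4 ^ Suc (Suc j)"] 
      mult_left_mono[OF lo less_imp_le[OF Dpos]] mult_left_mono[OF hi less_imp_le[OF Dpos]]
    by simp
  also have "\<dots> < D / (2 * real L)"
    using J[OF large large, of "Suc j" j] by (simp add: j_def)
  finally show False by (simp add: field_simps)
qed

lemma pigeonhole_fibre:
  assumes "finite E" "h ` E \<subseteq> C" "finite C" "C \<noteq> {}"
  obtains c where "c \<in> C" "card E \<le> card C * card {u \<in> E. h u = c}"
proof -
  let ?g = "\<lambda>d. card {u \<in> E. h u = d}"
  obtain c where c: "c \<in> C" "Max (?g ` C) = ?g c"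
    using obtains_MAX[OF assms(3,4), of ?g] by blast
  have max: "?g d \<le> ?g c" if "d \<in> C" for d
    using Max_ge[OF finite_imageI[OF assms(3)] imageI[OF that], of ?g] c(2) by simp
  have "E = (\<Union>d\<in>C. {u \<in> E. h u = d})" using assms(2) by auto
  then have "card E \<le> (\<Sum>d\<in>C. card {u \<in> E. h u = d})"
    using card_UN_le[OF assms(3), of "\<lambda>d. {u \<in> E. h u = d}"] by simp
  also have "\<dots> \<le> of_nat (card C) * card {u \<in> E. h u = c}"
    using max by (intro sum_bounded_above)
  finally show ?thesis using that c(1) by simp
qed

section \<open>Irregular points that follow freely chosen orbit segments\<close>

text \<open>A long orbit segment with large average is closed up; the connecting pieces,
  of bounded length, cost at most \<open>\<kappa>\<close> in the average.\<close>

lemma loop_with_prescribed_average: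
  fixes \<Phi> :: "'a::metric_space \<Rightarrow> real"
  assumes loop: "\<And>u n. u \<in> Y \<Longrightarrow> n > 0 \<Longrightarrow> \<exists>xs ys. length xs \<le> T \<and> length ys \<le> T \<and>
      pseudo_path f \<delta> p (xs @ orbit_segment f u n @ ys) p"
    and bound: "\<And>x. \<bar>\<Phi> x\<bar> \<le> B"
    and high: "\<And>n. \<exists>x\<in>Y. real n * I \<le> (\<Sum>i<n. \<Phi> ((f ^^ i) x))" and "\<kappa> > 0"
  obtains xs where "pseudo_path f \<delta> p xs p" "sum_list (map \<Phi> xs) \<ge> real (length xs) * (I - \<kappa>)"
proof -
  \<comment> \<open>the worst case for the sum of \<open>\<Phi> - (I - \<kappa>)\<close> over both connecting pieces\<close>
  define K where "K = 2 * real T * (B + \<bar>I - \<kappa>\<bar>)"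
  obtain m :: nat where m: "m > 0" "real m * \<kappa> \<ge> K"
  proof -
    obtain m :: nat where "real m * \<kappa> > K" using reals_Archimedean3[OF \<open>\<kappa> > 0\<close>] by blast
    then have "real (Suc m) * \<kappa> \<ge> K" using \<open>\<kappa> > 0\<close> by (simp add: algebra_simps)
    then show ?thesis using that by blast
  qed
  obtain x where x: "x \<in> Y" "real m * I \<le> (\<Sum>i<m. \<Phi> ((f ^^ i) x))" using high by blast
  obtain xs ys where l: "length xs \<le> T" "length ys \<le> T" 
    and path: "pseudo_path f \<delta> p (xs @ orbit_segment f x m @ ys) p" using loop[OF x(1) m(1)] by blast
  have conn: "sum_list (map \<Phi> zs) - real (length zs) * (I - \<kappa>) \<ge> - (real T * (B + \<bar>I - \<kappa>\<bar>))" 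
    if "length zs \<le> T" for zs
  proof -
    have "sum_list (map \<Phi> zs) - real (length zs) * (I - \<kappa>) \<ge> - (real (length zs) * (B + \<bar>I - \<kappa>\<bar>))" for zs
    proof (induction zs)
      case (Cons z zs)
      have "\<bar>\<Phi> z\<bar> \<le> B" by (rule bound)
      with Cons show ?case by (simp add: algebra_simps abs_if split: if_splits)
    qed simp
    moreover have "real (length zs) * (B + \<bar>I - \<kappa>\<bar>) \<le> real T * (B + \<bar>I - \<kappa>\<bar>)"
      using that bound[of undefined] by (intro mult_right_mono) auto
    ultimately show ?thesis by (smt (verit))
  qed
  have "sum_list (map \<Phi> (orbit_segment f x m)) = (\<Sum>i<m. \<Phi> ((f ^^ i) x))"
    by (simp add: o_def interv_sum_list_conv_sum_set_nat atLeast0LessThan)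
  then have "sum_list (map \<Phi> (xs @ orbit_segment f x m @ ys)) \<ge> real (length (xs @ orbit_segment f x m @ ys)) * (I - \<kappa>)"
    using conn[OF l(1)] conn[OF l(2)] m(2) x(2) by (simp add: K_def algebra_simps)
  then show ?thesis using that path by blast
qed

text \<open>Loops with large and with small averages need not have equal length. Repeating each
  of them as often as the other one is long makes the lengths equal.\<close>

lemma equal_length_loops_with_different_averages:
  fixes \<Phi> :: "'a::metric_space \<Rightarrow> real"
  assumes loop: "\<And>u n. u \<in> Y \<Longrightarrow> n > 0 \<Longrightarrow> \<exists>xs ys. length xs \<le> T \<and> length ys \<le> T \<and>
      pseudo_path f \<delta> p (xs @ orbit_segment f u n @ ys) p"
    and bound: "\<And>x. \<bar>\<Phi> x\<bar> \<le> B"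
    and high: "\<And>n. \<exists>x\<in>Y. real n * I1 \<le> (\<Sum>i<n. \<Phi> ((f ^^ i) x))"
    and low: "\<And>n. \<exists>x\<in>Y. (\<Sum>i<n. \<Phi> ((f ^^ i) x)) \<le> real n * I2" 
    and "\<kappa> > 0" "I1 - I2 \<ge> 3 * \<kappa>"
  obtains l where "l > 0"
    "\<And>r. r > 0 \<Longrightarrow> \<exists>xs ys. pseudo_path f \<delta> p xs p \<and> pseudo_path f \<delta> p ys p \<and> 
        length xs = r * l \<and> length ys = r * l \<and>
        sum_list (map \<Phi> xs) - sum_list (map \<Phi> ys) \<ge> real (r * l) * \<kappa>"
proof -
  obtain xs where xs: "pseudo_path f \<delta> p xs p" "sum_list (map \<Phi> xs) \<ge> real (length xs) * (I1 - \<kappa>)"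
    using loop_with_prescribed_average[OF loop bound high \<open>\<kappa> > 0\<close>] by blast
  have "\<exists>x\<in>Y. real n * (- I2) \<le> (\<Sum>i<n. - \<Phi> ((f ^^ i) x))" for n
    using low[of n] by (auto simp: sum_negf)
  then obtain ys where ys: "pseudo_path f \<delta> p ys p" 
    "sum_list (map (\<lambda>x. - \<Phi> x) ys) \<ge> real (length ys) * (- I2 - \<kappa>)"
    using loop_with_prescribed_average[where \<Phi> = "\<lambda>x. - \<Phi> x" and I = "- I2", OF loop _ _ \<open>\<kappa> > 0\<close>] bound
    by (metis abs_minus_cancel)
  have neg: "sum_list (map (\<lambda>x. - \<Phi> x) zs) = - sum_list (map \<Phi> zs)" for zs
    by (induction zs) auto
  have rep: "sum_list (map \<Phi> (concat (replicate k zs))) = real k * sum_list (map \<Phi> zs)" for k zs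
    by (induction k) (auto simp: algebra_simps)
  have len: "length (concat (replicate k zs)) = k * length zs" for k and zs :: "'a list"
    by (induction k) auto
  define l where "l = length xs * length ys"
  have "length xs > 0" "length ys > 0" using xs(1) ys(1) by (auto simp: pseudo_path_def)
  show ?thesis
  proof (rule that)
    show "l > 0" using \<open>length xs > 0\<close> \<open>length ys > 0\<close> by (simp add: l_def)
    fix r :: nat assume "r > 0"
    define xs' where "xs' = concat (replicate (r * length ys) xs)"
    define ys' where "ys' = concat (replicate (r * length xs) ys)"
    have "real (r * length ys) * (real (length xs) * (I1 - \<kappa>)) \<le> sum_list (map \<Phi> xs')"
      unfolding xs'_def rep using xs(2) by (intro mult_left_mono) auto
    moreover have "sum_list (map \<Phi> ys) \<le> real (length ys) * (I2 + \<kappa>)"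
      using ys(2) unfolding neg by (simp add: algebra_simps)
    then have "sum_list (map \<Phi> ys') \<le> real (r * length xs) * (real (length ys) * (I2 + \<kappa>))"
      unfolding ys'_def rep by (intro mult_left_mono) auto
    moreover have "real (r * l) * \<kappa> \<le> real (r * l) * ((I1 - \<kappa>) - (I2 + \<kappa>))"
      using \<open>I1 - I2 \<ge> 3 * \<kappa>\<close> by (intro mult_left_mono) auto
    ultimately have "sum_list (map \<Phi> xs') - sum_list (map \<Phi> ys') \<ge> real (r * l) * \<kappa>"
      by (simp add: l_def algebra_simps)
    moreover have "pseudo_path f \<delta> p xs' p" "pseudo_path f \<delta> p ys' p"
      unfolding xs'_def ys'_def using pseudo_path_replicate xs(1) ys(1) \<open>r > 0\<close> 
        \<open>length xs > 0\<close> \<open>length ys > 0\<close> by (metis nat_0_less_mult_iff)+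
    moreover have "length xs' = r * l" "length ys' = r * l"
      by (simp_all only: xs'_def ys'_def len l_def mult_ac)
    ultimately show "\<exists>xs ys. pseudo_path f \<delta> p xs p \<and> pseudo_path f \<delta> p ys p \<and> 
        length xs = r * l \<and> length ys = r * l \<and>
        sum_list (map \<Phi> xs) - sum_list (map \<Phi> ys) \<ge> real (r * l) * \<kappa>" by blast
  qed
qed

text \<open>Two pseudo-orbits with the same free loops \<open>F b\<close> are shadowed. They differ in the
  control loops that are appended: always \<open>c\<close> in the first, \<open>c'\<close> at oscillating positions in
  the second. One of the two shadowing points is irregular.\<close>

lemma irregular_point_following_loops:
  fixes f :: "'a::metric_space \<Rightarrow> 'a" and \<Phi> :: "'a \<Rightarrow> real"
  assumes cpt: "compact (UNIV :: 'a set)" and cont: "continuous_on UNIV f"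
    and shad: "\<And>x. pseudo_orbit f \<delta> x \<Longrightarrow> \<exists>y. \<forall>n. dist (x n) ((f ^^ n) y) < e"
    and \<Phi>: "\<And>x y. dist x y \<le> e \<Longrightarrow> \<bar>\<Phi> x - \<Phi> y\<bar> \<le> \<eta>"
    and F: "\<And>b. pseudo_path f \<delta> p (F b) p" "\<And>b. length (F b) = N"
    and c: "pseudo_path f \<delta> p c p" "length c = M" and c': "pseudo_path f \<delta> p c' p" "length c' = M"
    and gap: "sum_list (map \<Phi> c') - sum_list (map \<Phi> c) > 8 * \<eta> * real (N + M)"
  obtains z where "z \<in> irregular_set \<Phi> f \<inter> chain_recurrent_set f"
    "\<And>b i. i < N \<Longrightarrow> dist (F b ! i) ((f ^^ (b * (N + M) + i)) z) \<le> e"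
proof -
  define L where "L = N + M"
  define W where "W = (\<lambda>\<sigma> b. F b @ (if \<sigma> b then c' else c))"
  have len: "length (W \<sigma> b) = L" for \<sigma> b using F(2) c(2) c'(2) by (simp add: W_def L_def)
  have loop: "pseudo_path f \<delta> p (W \<sigma> b) p" for \<sigma> b
    using pseudo_path_append[OF F(1) c(1)] pseudo_path_append[OF F(1) c'(1)] by (simp add: W_def)
  have "L > 0" using F(1)[of 0] F(2)[of 0] by (auto simp: L_def pseudo_path_def)
  have start: "W \<sigma> b ! 0 = p" for \<sigma> b
    using loop[of \<sigma> b] by (auto simp: pseudo_path_def hd_conv_nth)
  have "\<exists>z. z \<in> chain_recurrent_set f \<and> (\<forall>n. dist (block_sequence L (W \<sigma>) n) ((f ^^ n) z) \<le> e)" for \<sigma>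
  proof -
    have "block_sequence L (W \<sigma>) (k * L) = block_sequence L (W \<sigma>) 0" for k
      using block_sequence_nth[OF \<open>L > 0\<close>, of "W \<sigma>"] start by (metis add_0_right mult_0)
    from recurrent_pseudo_orbit_shadowed_in_chain_recurrent_set[OF cpt cont shad
          pseudo_orbit_block_sequence[OF \<open>L > 0\<close> len loop] this \<open>L > 0\<close>]
    show ?thesis by blast
  qed
  then obtain z where z: "\<And>\<sigma>. z \<sigma> \<in> chain_recurrent_set f"
      "\<And>\<sigma> n. dist (block_sequence L (W \<sigma>) n) ((f ^^ n) (z \<sigma>)) \<le> e" by metis
  define D where "D = sum_list (map \<Phi> c') - sum_list (map \<Phi> c)"
  have near: "\<bar>\<Phi> ((f ^^ i) (z \<sigma>)) - \<Phi> (block_sequence L (W \<sigma>) i)\<bar> \<le> \<eta>" for i \<sigma>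
    using \<Phi> z(2) by (simp add: dist_commute)
  have "z (\<lambda>_. False) \<in> irregular_set \<Phi> f \<or> z oscillating \<in> irregular_set \<Phi> f"
  proof (rule irregular_by_comparison[where \<Phi> = \<Phi> and f = f and a = "\<lambda>i. \<Phi> (block_sequence L (W (\<lambda>_. False)) i)"
        and a' = "\<lambda>i. \<Phi> (block_sequence L (W oscillating) i)", OF near[of _ "\<lambda>_. False"] near[of _ oscillating] \<open>L > 0\<close>])
    show "8 * \<eta> * real L < D" using gap by (simp add: D_def L_def)
    fix k
    have "(\<Sum>i<k * L. \<Phi> (block_sequence L (W oscillating) i) - \<Phi> (block_sequence L (W (\<lambda>_. False)) i))
       = (\<Sum>b<k. sum_list (map \<Phi> (W oscillating b)) - sum_list (map \<Phi> (W (\<lambda>_. False) b)))"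
      using sum_block_sequence[of "W oscillating" L \<Phi> k] sum_block_sequence[of "W (\<lambda>_. False)" L \<Phi> k] len
      by (simp add: sum_subtractf)
    also have "\<dots> = (\<Sum>b<k. if oscillating b then D else 0)"
      by (intro sum.cong) (auto simp: W_def D_def)
    also have "\<dots> = D * real (card {b. b < k \<and> oscillating b})"
    proof -
      have "{..<k} \<inter> {b. oscillating b} = {b. b < k \<and> oscillating b}" by auto
      then show ?thesis by (simp add: sum.If_cases)
    qed
    finally show "(\<Sum>i<k * L. \<Phi> (block_sequence L (W oscillating) i) - \<Phi> (block_sequence L (W (\<lambda>_. False)) i))
       = D * real (card {b. b < k \<and> oscillating b})" .
  qed
  then obtain \<sigma> where \<sigma>: "z \<sigma> \<in> irregular_set \<Phi> f" by blast
  show ?thesis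
  proof (rule that)
    show "z \<sigma> \<in> irregular_set \<Phi> f \<inter> chain_recurrent_set f" using \<sigma> z(1) by blast
    fix b i assume "i < N"
    then have "block_sequence L (W \<sigma>) (b * L + i) = F b ! i"
      using block_sequence_nth[of i L "W \<sigma>" b] F(2)[of b] by (simp add: W_def L_def nth_append)
    then show "dist (F b ! i) ((f ^^ (b * (N + M) + i)) (z \<sigma>)) \<le> e"
      using z(2)[of \<sigma> "b * L + i"] by (simp add: L_def)
  qed
qed

text \<open>This is a specification property for the points of \<open>E\<close>, with fixed gaps of length
  \<open>L - n\<close> and infinitely many prescribed segments.\<close>

definition traces_all ::
  "('a::metric_space \<Rightarrow> 'a) \<Rightarrow> 'a set \<Rightarrow> 'a set \<Rightarrow> nat \<Rightarrow> nat \<Rightarrow> nat \<Rightarrow> real \<Rightarrow> bool" where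
  "traces_all f Z E n L \<tau> e \<longleftrightarrow> (\<forall>\<omega>. range \<omega> \<subseteq> E \<longrightarrow>
     (\<exists>z\<in>Z. \<forall>b. \<forall>i<n. dist ((f ^^ i) (\<omega> b)) ((f ^^ (b * L + \<tau> + i)) z) \<le> e))"

text \<open>The free segments are \<open>g\<close> times as long as the control loops, so a large \<open>g\<close>
  makes the control loops cheap in terms of entropy. The accuracy \<open>\<eta>\<close> required by the comparison
  depends on \<open>g\<close>; it fixes the shadowing scale, hence \<open>\<delta>\<close>, hence \<open>T\<close>, before the length \<open>M\<close> is chosen.
  The factor \<open>T\<^sup>2\<close> is the loss in choosing, by the pigeonhole principle, one pair of lengths for the
  connecting pieces on both sides of the segment.\<close>

lemma irregular_points_following_free_orbit_segments:
  fixes f :: "'a::metric_space \<Rightarrow> 'a" and \<Phi> :: "'a \<Rightarrow> real"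
  assumes cpt: "compact (UNIV :: 'a set)" and cont: "continuous_on UNIV f"
    and shad: "shadowing_property f"
    and rel: "\<And>u. u \<in> Y \<Longrightarrow> chain_related f p u" and inv: "f ` Y \<subseteq> Y"
    and cont_\<Phi>: "continuous_on UNIV \<Phi>"
    and high: "\<And>n. \<exists>x\<in>Y. real n * I1 \<le> (\<Sum>i<n. \<Phi> ((f ^^ i) x))"
    and low: "\<And>n. \<exists>x\<in>Y. (\<Sum>i<n. \<Phi> ((f ^^ i) x)) \<le> real n * I2" 
    and "I2 < I1" "e > 0" "g > 0"
  obtains T where "T > 0"
    "\<And>n0. \<exists>M>n0. \<forall>E. E \<subseteq> Y \<longrightarrow> finite E \<longrightarrow> (\<exists>E' \<tau> L. E' \<subseteq> E \<and> card E \<le> T\<^sup>2 * card E' \<and>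
        \<tau> + g * M \<le> L \<and> L \<le> (g + 1) * M + 2 * T \<and>
        traces_all f (irregular_set \<Phi> f \<inter> chain_recurrent_set f \<inter> cball p e) E' (g * M) L \<tau> e)"
proof -
  define \<kappa> where "\<kappa> = (I1 - I2) / 3"
  have "\<kappa> > 0" using \<open>I2 < I1\<close> by (simp add: \<kappa>_def)
  \<comment> \<open>the comparison needs \<open>8 \<eta> L < M \<kappa>\<close>, and blocks have length \<open>L \<le> (g + 2) M\<close>\<close>
  define \<eta> where "\<eta> = \<kappa> / (9 * (real g + 2))"
  have "\<eta> > 0" using \<open>\<kappa> > 0\<close> by (simp add: \<eta>_def)
  have "uniformly_continuous_on UNIV \<Phi>"
    using compact_uniformly_continuous[OF cont_\<Phi> cpt] .
  then obtain d where d: "d > 0" "\<And>x y. dist x y < d \<Longrightarrow> \<bar>\<Phi> x - \<Phi> y\<bar> < \<eta>"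
    using \<open>\<eta> > 0\<close> unfolding uniformly_continuous_on_def by (metis UNIV_I dist_commute dist_real_def)
  define e' where "e' = min e (d / 2)"
  have e': "e' > 0" "e' \<le> e" "e' < d" using \<open>e > 0\<close> d(1) by (auto simp: e'_def)
  have mod: "\<bar>\<Phi> x - \<Phi> y\<bar> \<le> \<eta>" if "dist x y \<le> e'" for x y
    using d(2)[of x y] that e'(3) by simp
  obtain \<delta> where "\<delta> > 0" and \<delta>: "\<And>x. pseudo_orbit f \<delta> x \<Longrightarrow> \<exists>y. \<forall>n. dist (x n) ((f ^^ n) y) < e'"
    using shad e'(1) unfolding shadowing_property_def by meson
  obtain T where T: "\<And>u n. u \<in> Y \<Longrightarrow> n > 0 \<Longrightarrow> \<exists>xs ys. length xs \<le> T \<and> length ys \<le> T \<and>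
      pseudo_path f \<delta> p (xs @ orbit_segment f u n @ ys) p"
    using loop_through_orbit_segment[OF cpt \<open>\<delta> > 0\<close> rel inv] by blast
  have "bounded (range \<Phi>)" using compact_continuous_image[OF cont_\<Phi> cpt] compact_imp_bounded by blast
  then obtain B where B: "\<And>x. \<bar>\<Phi> x\<bar> \<le> B" by (auto simp: bounded_iff)
  have "I1 - I2 \<ge> 3 * \<kappa>" by (simp add: \<kappa>_def)
  then obtain l where "l > 0" and l: "\<And>r. r > 0 \<Longrightarrow> \<exists>xs ys. pseudo_path f \<delta> p xs p \<and> pseudo_path f \<delta> p ys p \<and> 
        length xs = r * l \<and> length ys = r * l \<and>
        sum_list (map \<Phi> xs) - sum_list (map \<Phi> ys) \<ge> real (r * l) * \<kappa>"
    using equal_length_loops_with_different_averages[OF T B high low \<open>\<kappa> > 0\<close>] by metis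
  show ?thesis
  proof (rule that[of "Suc T"])
    fix n0
    \<comment> \<open>the summand \<open>2 T\<close> makes the connecting pieces no longer than one control loop\<close>
    define r where "r = Suc (n0 + 2 * T)"
    define M where "M = r * l"
    have M: "M \<ge> r" using \<open>l > 0\<close> by (cases l) (auto simp: M_def)
    then have "M > n0" "M \<ge> 2 * T" "M > 0" by (auto simp: r_def)
    obtain c c' where c': "pseudo_path f \<delta> p c' p" "length c' = M" and c: "pseudo_path f \<delta> p c p" "length c = M"
      and gap: "sum_list (map \<Phi> c') - sum_list (map \<Phi> c) \<ge> real M * \<kappa>"
      using l[of r] by (auto simp: M_def r_def)
    define n where "n = g * M"
    have "n > 0" using \<open>M > 0\<close> \<open>g > 0\<close> by (simp add: n_def)
    obtain X Z where X: "\<And>u. u \<in> Y \<Longrightarrow> length (X u) \<le> T" and Z: "\<And>u. u \<in> Y \<Longrightarrow> length (Z u) \<le> T"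
      and XZ: "\<And>u. u \<in> Y \<Longrightarrow> pseudo_path f \<delta> p (X u @ orbit_segment f u n @ Z u) p"
      using T[OF _ \<open>n > 0\<close>] by metis
    have "\<exists>E' \<tau> L. E' \<subseteq> E \<and> card E \<le> (Suc T)\<^sup>2 * card E' \<and>
        \<tau> + g * M \<le> L \<and> L \<le> (g + 1) * M + 2 * Suc T \<and>
        traces_all f (irregular_set \<Phi> f \<inter> chain_recurrent_set f \<inter> cball p e) E' (g * M) L \<tau> e"
      if E: "E \<subseteq> Y" "finite E" for E
    proof -
      have "(\<lambda>u. (length (X u), length (Z u))) ` E \<subseteq> {..T} \<times> {..T}" using X Z E(1) by auto
      from pigeonhole_fibre[OF E(2) this] obtain k where k: "k \<in> {..T} \<times> {..T}" 
        "card E \<le> card ({..T} \<times> {..T}) * card {u \<in> E. (length (X u), length (Z u)) = k}"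
        by auto
      obtain \<tau> \<tau>' where k_eq: "k = (\<tau>, \<tau>')" by force
      define E' where "E' = {u \<in> E. length (X u) = \<tau> \<and> length (Z u) = \<tau>'}"
      define N where "N = \<tau> + n + \<tau>'"
      have \<tau>: "\<tau> \<le> T" "\<tau>' \<le> T" using k(1) k_eq by auto
      have small: "8 * \<eta> * real (N + M) < real M * \<kappa>"
      proof -
        have "N + M \<le> (g + 2) * M" using \<tau> \<open>M \<ge> 2 * T\<close> by (simp add: N_def n_def algebra_simps)
        then have "real (N + M) \<le> real ((g + 2) * M)" by (simp only: of_nat_le_iff)
        then have "real (N + M) \<le> (real g + 2) * real M" by (simp add: distrib_right)
        then have "8 * \<eta> * real (N + M) \<le> 8 * \<eta> * ((real g + 2) * real M)"
          using \<open>\<eta> > 0\<close> by (intro mult_left_mono) auto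
        also have "\<dots> = 8 / 9 * \<kappa> * real M" by (simp add: \<eta>_def field_simps)
        also have "\<dots> < real M * \<kappa>" using \<open>\<kappa> > 0\<close> \<open>M > 0\<close> by simp
        finally show ?thesis .
      qed
      have "\<exists>z \<in> irregular_set \<Phi> f \<inter> chain_recurrent_set f \<inter> cball p e.
          \<forall>b. \<forall>i < g * M. dist ((f ^^ i) (\<omega> b)) ((f ^^ (b * (N + M) + \<tau> + i)) z) \<le> e"
        if \<omega>: "range \<omega> \<subseteq> E'" for \<omega> :: "nat \<Rightarrow> 'a"
      proof -
        have \<omega>Y: "\<omega> b \<in> Y" "length (X (\<omega> b)) = \<tau>" "length (Z (\<omega> b)) = \<tau>'" for b
          using \<omega> E(1) by (auto simp: E'_def)
        define F where "F = (\<lambda>b. X (\<omega> b) @ orbit_segment f (\<omega> b) n @ Z (\<omega> b))"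
        have F: "pseudo_path f \<delta> p (F b) p" "length (F b) = N" for b
          using XZ \<omega>Y by (simp_all add: F_def N_def)
        have gap': "8 * \<eta> * real (N + M) < sum_list (map \<Phi> c') - sum_list (map \<Phi> c)"
          using small gap by linarith
        obtain z where z: "z \<in> irregular_set \<Phi> f \<inter> chain_recurrent_set f"
          "\<And>b i. i < N \<Longrightarrow> dist (F b ! i) ((f ^^ (b * (N + M) + i)) z) \<le> e'"
          using irregular_point_following_loops[where F = F, OF cpt cont \<delta> mod F c c' gap'] by blast
        have "F 0 ! 0 = p" using F(1)[of 0] by (auto simp: pseudo_path_def hd_conv_nth)
        then have "dist p z \<le> e" using z(2)[of 0 0] e'(2) \<open>n > 0\<close> by (simp add: N_def)
        moreover have "dist ((f ^^ i) (\<omega> b)) ((f ^^ (b * (N + M) + \<tau> + i)) z) \<le> e" if "i < g * M" for b i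
        proof -
          have "F b ! (\<tau> + i) = (f ^^ i) (\<omega> b)"
            using that \<omega>Y(2)[of b] by (simp add: F_def n_def nth_append)
          then show ?thesis
            using z(2)[of "\<tau> + i" b] that e'(2) by (simp add: N_def n_def add.assoc)
        qed
        ultimately show ?thesis using z(1) by (intro bexI[of _ z]) auto
      qed
      then have "traces_all f (irregular_set \<Phi> f \<inter> chain_recurrent_set f \<inter> cball p e) E' (g * M) (N + M) \<tau> e"
        unfolding traces_all_def by blast
      moreover have "card E \<le> (Suc T)\<^sup>2 * card E'"
        using k(2) by (simp add: k_eq E'_def power2_eq_square)
      moreover have "\<tau> + g * M \<le> N + M" "N + M \<le> (g + 1) * M + 2 * Suc T"
        using \<tau> by (auto simp: N_def n_def)
      moreover have "E' \<subseteq> E" by (auto simp: E'_def)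
      ultimately show ?thesis by blast
    qed
    then show "\<exists>M>n0. \<forall>E. E \<subseteq> Y \<longrightarrow> finite E \<longrightarrow> (\<exists>E' \<tau> L. E' \<subseteq> E \<and> card E \<le> (Suc T)\<^sup>2 * card E' \<and>
        \<tau> + g * M \<le> L \<and> L \<le> (g + 1) * M + 2 * Suc T \<and>
        traces_all f (irregular_set \<Phi> f \<inter> chain_recurrent_set f \<inter> cball p e) E' (g * M) L \<tau> e)"
      using \<open>M > n0\<close> by blast
  qed simp
qed

section \<open>Bowen entropy and the distribution principle\<close>

lemma bowen_dist_less_iff:
  assumes "n > 0"
  shows "bowen_dist f n x y < r \<longleftrightarrow> (\<forall>i<n. dist ((f ^^ i) x) ((f ^^ i) y) < r)"
  using assms unfolding bowen_dist_def by (subst Max_less_iff) auto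

lemma incseq_bowen_outer: "incseq (\<lambda>n. bowen_outer f Z t n \<epsilon>)"
  unfolding incseq_def bowen_outer_def
proof (intro allI impI INF_superset_mono)
  fix m n :: nat assume "m \<le> n"
  then show "bowen_covers f Z n \<epsilon> \<subseteq> bowen_covers f Z m \<epsilon>"
    by (fastforce simp: bowen_covers_def)
qed auto

lemma bowen_outer_lim_eq_SUP: "bowen_outer_lim f Z t \<epsilon> = (SUP n. bowen_outer f Z t n \<epsilon>)"
  unfolding bowen_outer_lim_def by (intro limI LIMSEQ_SUP incseq_bowen_outer)

lemma bowen_entropy_at_ge_if_outer_ge:
  assumes "\<And>t'. t' < t \<Longrightarrow> \<exists>c>0. \<exists>n. bowen_outer f Z t' n \<theta> \<ge> c"
  shows "ereal t \<le> bowen_entropy_at f Z \<theta>"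
  unfolding bowen_entropy_at_def
proof (rule Inf_greatest)
  fix h assume "h \<in> {ereal t |t. bowen_outer_lim f Z t \<theta> = 0}"
  then obtain t' where t': "h = ereal t'" "bowen_outer_lim f Z t' \<theta> = 0" by auto
  have "\<not> t' < t"
  proof
    assume "t' < t"
    then obtain c n where "c > 0" "bowen_outer f Z t' n \<theta> \<ge> c" using assms by blast
    then have "bowen_outer_lim f Z t' \<theta> \<ge> c"
      unfolding bowen_outer_lim_eq_SUP by (metis SUP_upper2 UNIV_I)
    then show False using t'(2) \<open>c > 0\<close> by simp
  qed
  then show "ereal t \<le> h" using t'(1) by simp
qed

lemma bowen_entropy_at_mono:
  assumes "Z \<subseteq> Z'" "\<theta>' \<le> \<theta>"
  shows "bowen_entropy_at f Z \<theta> \<le> bowen_entropy_at f Z' \<theta>'"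
proof -
  have ball: "bowen_ball f v x \<theta>' \<subseteq> bowen_ball f v x \<theta>" for v x
    using assms(2) by (auto simp: bowen_ball_def)
  have "bowen_covers f Z' n \<theta>' \<subseteq> bowen_covers f Z n \<theta>" for n
  proof
    fix C assume "C \<in> bowen_covers f Z' n \<theta>'"
    then have C: "countable C" "\<forall>(x, v)\<in>C. v \<ge> n" "Z' \<subseteq> (\<Union>(x, v)\<in>C. bowen_ball f v x \<theta>')"
      by (auto simp: bowen_covers_def)
    have "Z \<subseteq> (\<Union>(x, v)\<in>C. bowen_ball f v x \<theta>)"
    proof
      fix y assume "y \<in> Z"
      then obtain x v where "(x, v) \<in> C" "y \<in> bowen_ball f v x \<theta>'" using C(3) assms(1) by blast
      then show "y \<in> (\<Union>(x, v)\<in>C. bowen_ball f v x \<theta>)" using ball by blast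
    qed
    then show "C \<in> bowen_covers f Z n \<theta>" using C by (simp add: bowen_covers_def)
  qed
  then have "bowen_outer f Z t n \<theta> \<le> bowen_outer f Z' t n \<theta>'" for t n
    unfolding bowen_outer_def by (intro INF_superset_mono) auto
  then have "bowen_outer_lim f Z t \<theta> \<le> bowen_outer_lim f Z' t \<theta>'" for t
    unfolding bowen_outer_lim_eq_SUP by (intro SUP_mono) auto
  then have "bowen_outer_lim f Z t \<theta> = 0" if "bowen_outer_lim f Z' t \<theta>' = 0" for t
    using that by (metis le_zero_eq)
  then show ?thesis
    unfolding bowen_entropy_at_def by (intro Inf_superset_mono) auto
qed

lemma bowen_entropy_eq_SUP:
  "bowen_entropy f Z = (SUP \<theta>\<in>{0<..}. bowen_entropy_at f Z \<theta>)"
  unfolding bowen_entropy_def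
proof (rule tendsto_Lim)
  show "((\<lambda>\<theta>. bowen_entropy_at f Z \<theta>) \<longlongrightarrow> (SUP \<theta>\<in>{0<..}. bowen_entropy_at f Z \<theta>)) (at_right 0)"
  proof (rule increasing_tendsto)
    show "\<forall>\<^sub>F \<theta> in at_right 0. bowen_entropy_at f Z \<theta> \<le> (SUP \<theta>\<in>{0<..}. bowen_entropy_at f Z \<theta>)"
      unfolding eventually_at_right_field by (auto intro!: exI[of _ 1] SUP_upper)
    fix h assume "h < (SUP \<theta>\<in>{0<..}. bowen_entropy_at f Z \<theta>)"
    then obtain r :: real where r: "r > 0" "h < bowen_entropy_at f Z r"
      by (auto simp: less_SUP_iff)
    then show "\<forall>\<^sub>F \<theta> in at_right 0. h < bowen_entropy_at f Z \<theta>"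
      unfolding eventually_at_right_field
      using bowen_entropy_at_mono[OF order_refl] by (metis less_imp_le less_le_trans)
  qed
qed auto

text \<open>A cylinder that fixes \<open>j\<close> coordinates has uniform product measure at most
  \<open>(1 / card E)\<^sup>j\<close>, so this is countable subadditivity. Equality may fail because the entries
  of \<open>w c\<close> are allowed to lie outside \<open>E\<close>.\<close>

lemma cylinder_cover_weight_ge_1:
  fixes E :: "'b set" and j :: "'c \<Rightarrow> nat" and w :: "'c \<Rightarrow> nat \<Rightarrow> 'b"
  assumes "finite E" "E \<noteq> {}" "countable C"
    and cover: "\<And>\<omega>. range \<omega> \<subseteq> E \<Longrightarrow> \<exists>c\<in>C. \<forall>i < j c. \<omega> i = w c i"
  shows "(\<Sum>\<^sub>\<infinity>c\<in>C. ennreal ((1 / real (card E)) ^ j c)) \<ge> 1"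
proof -
  define U where "U = uniform_count_measure E"
  interpret U: prob_space U
    unfolding U_def using assms by (intro prob_space_uniform_count_measure)
  interpret P: product_prob_space "\<lambda>_::nat. U" UNIV ..
  let ?P = "PiM UNIV (\<lambda>_::nat. U)"
  have sets_U: "sets U = Pow E" and space_U: "space U = E"
    by (auto simp: U_def sets_uniform_count_measure space_uniform_count_measure)
  have space_P: "space ?P = {\<omega>. range \<omega> \<subseteq> E}"
    by (auto simp: space_PiM space_U PiE_def)
  define cyl where "cyl = (\<lambda>c. prod_emb UNIV (\<lambda>_. U) {..<j c} (\<Pi>\<^sub>E i\<in>{..<j c}. {w c i} \<inter> E))"
  have cyl_sets: "cyl c \<in> sets ?P" for c
    unfolding cyl_def by (intro sets_PiM_I) (auto simp: sets_U)
  have cyl_le: "emeasure ?P (cyl c) \<le> ennreal ((1 / real (card E)) ^ j c)" for c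
  proof -
    have "emeasure ?P (cyl c) = (\<Prod>i\<in>{..<j c}. emeasure U ({w c i} \<inter> E))"
      unfolding cyl_def by (rule P.emeasure_PiM_emb) (auto simp: sets_U)
    also have "\<dots> \<le> (\<Prod>i\<in>{..<j c}. ennreal (1 / real (card E)))"
    proof (rule prod_mono_ennreal)
      fix i
      have "card ({w c i} \<inter> E) \<le> card {w c i}" by (intro card_mono) auto
      then have "real (card ({w c i} \<inter> E)) / real (card E) \<le> 1 / real (card E)"
        by (intro divide_right_mono) auto
      then show "emeasure U ({w c i} \<inter> E) \<le> ennreal (1 / real (card E))"
        using assms(1) by (simp add: U_def emeasure_uniform_count_measure)
    qed
    also have "\<dots> = ennreal ((1 / real (card E)) ^ j c)" by (simp add: ennreal_power)
    finally show ?thesis .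
  qed
  have cov: "space ?P \<subseteq> (\<Union>c\<in>C. cyl c)"
  proof
    fix \<omega> assume \<omega>: "\<omega> \<in> space ?P"
    then obtain c where "c \<in> C" "\<forall>i < j c. \<omega> i = w c i" using cover space_P by blast
    then show "\<omega> \<in> (\<Union>c\<in>C. cyl c)" using \<omega> unfolding cyl_def by (auto simp: prod_emb_def space_P space_PiM space_U PiE_iff)
  qed
  \<comment> \<open>enumerating \<open>C\<close> turns the unordered sum into a bound for all partial sums of the series of measures\<close>
  have fin_le: "(\<Sum>n<k. if n \<in> to_nat_on C ` C then emeasure ?P (cyl (from_nat_into C n)) else 0)
      \<le> (\<Sum>\<^sub>\<infinity>c\<in>C. ennreal ((1 / real (card E)) ^ j c))" for k
  proof -
    define F where "F = {c \<in> C. to_nat_on C c < k}"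
    have inj: "inj_on (to_nat_on C) C" by (rule inj_on_to_nat_on[OF assms(3)])
    have F: "finite F" 
      by (rule finite_imageD[of "to_nat_on C"]) (auto simp: F_def intro: finite_subset[of _ "{..<k}"] inj_on_subset[OF inj])
    have "(\<Sum>n<k. if n \<in> to_nat_on C ` C then emeasure ?P (cyl (from_nat_into C n)) else 0)
        = (\<Sum>n\<in>to_nat_on C ` F. emeasure ?P (cyl (from_nat_into C n)))"
      by (rule sum.mono_neutral_cong_right) (auto simp: F_def)
    also have "\<dots> = (\<Sum>c\<in>F. emeasure ?P (cyl c))"
      by (subst sum.reindex) (auto simp: F_def assms(3) intro: inj_on_subset[OF inj] intro!: sum.cong)
    also have "\<dots> \<le> (\<Sum>c\<in>F. ennreal ((1 / real (card E)) ^ j c))" by (intro sum_mono cyl_le)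
    also have "\<dots> \<le> (\<Sum>\<^sub>\<infinity>c\<in>C. ennreal ((1 / real (card E)) ^ j c))"
      using F by (subst nonneg_infsum_complete) (auto simp: F_def intro!: SUP_upper)
    finally show ?thesis .
  qed
  define A where "A = (\<lambda>n. if n \<in> to_nat_on C ` C then cyl (from_nat_into C n) else {})"
  have "1 = emeasure ?P (space ?P)" by (simp add: P.emeasure_space_1)
  also have "\<dots> \<le> emeasure ?P (\<Union>n. A n)"
  proof (rule emeasure_mono)
    show "space ?P \<subseteq> (\<Union>n. A n)"
    proof
      fix \<omega> assume "\<omega> \<in> space ?P"
      then obtain c where "c \<in> C" "\<omega> \<in> cyl c" using cov by blast
      then have "\<omega> \<in> A (to_nat_on C c)" using assms(3) by (simp add: A_def)
      then show "\<omega> \<in> (\<Union>n. A n)" by blast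
    qed
    show "(\<Union>n. A n) \<in> sets ?P"
      using cyl_sets by (intro sets.countable_UN) (auto simp: A_def)
  qed
  also have "\<dots> \<le> (\<Sum>n. emeasure ?P (A n))"
    by (rule emeasure_subadditive_countably) (auto simp: A_def cyl_sets)
  also have "\<dots> \<le> (\<Sum>\<^sub>\<infinity>c\<in>C. ennreal ((1 / real (card E)) ^ j c))"
  proof (rule suminf_le_const)
    fix k
    have "(\<Sum>n<k. emeasure ?P (A n)) 
        = (\<Sum>n<k. if n \<in> to_nat_on C ` C then emeasure ?P (cyl (from_nat_into C n)) else 0)"
      by (intro sum.cong) (auto simp: A_def)
    then show "(\<Sum>n<k. emeasure ?P (A n)) \<le> (\<Sum>\<^sub>\<infinity>c\<in>C. ennreal ((1 / real (card E)) ^ j c))"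
      using fin_le by simp
  qed simp
  finally show ?thesis .
qed

text \<open>Two points of a Bowen ball of radius \<open>\<theta>\<close> and length \<open>v\<close> stay within \<open>2 \<theta>\<close> of each
  other, so sequences \<open>\<omega>\<close> whose points \<open>z \<omega>\<close> share the ball agree in the first \<open>v div L\<close> symbols. The
  sequences seen by one ball thus lie in a cylinder whose measure is, up to a constant factor, at
  most the weight \<open>exp (- t v)\<close>.\<close>

lemma entropy_distribution_principle:
  fixes E :: "'b set" and z :: "(nat \<Rightarrow> 'b) \<Rightarrow> 'a::metric_space"
  assumes E: "finite E" "E \<noteq> {}" and "L > 0" and t: "t \<ge> 0" "exp (t * real L) \<le> real (card E)"
    and z: "\<And>\<omega>. range \<omega> \<subseteq> E \<Longrightarrow> z \<omega> \<in> Z"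
    and sep: "\<And>\<omega> \<omega>' k b. range \<omega> \<subseteq> E \<Longrightarrow> range \<omega>' \<subseteq> E \<Longrightarrow> b < k \<Longrightarrow> 
      (\<forall>i < k * L. dist ((f ^^ i) (z \<omega>)) ((f ^^ i) (z \<omega>')) < 2 * \<theta>) \<Longrightarrow> \<omega> b = \<omega>' b"
  shows "ereal t \<le> bowen_entropy_at f Z \<theta>"
proof (rule bowen_entropy_at_ge_if_outer_ge)
  fix t' assume "t' < t"
  define c where "c = exp (- t * real L)"
  have "ennreal c \<le> bowen_outer f Z t' 1 \<theta>"
    unfolding bowen_outer_def
  proof (rule INF_greatest)
    fix C assume C: "C \<in> bowen_covers f Z 1 \<theta>"
    define w where "w = (\<lambda>(x, v). SOME \<omega>. range \<omega> \<subseteq> E \<and> z \<omega> \<in> bowen_ball f v x \<theta>)"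
    have cov: "\<exists>c\<in>C. \<forall>i < snd c div L. \<omega> i = w c i" if \<omega>: "range \<omega> \<subseteq> E" for \<omega>
    proof -
      obtain x v where xv: "(x, v) \<in> C" "z \<omega> \<in> bowen_ball f v x \<theta>"
        using z[OF \<omega>] C by (fastforce simp: bowen_covers_def)
      have "v > 0" using xv(1) C by (auto simp: bowen_covers_def)
      have w: "range (w (x, v)) \<subseteq> E" "z (w (x, v)) \<in> bowen_ball f v x \<theta>"
        using someI_ex[of "\<lambda>\<omega>. range \<omega> \<subseteq> E \<and> z \<omega> \<in> bowen_ball f v x \<theta>"] \<omega> xv(2) 
        unfolding w_def by auto
      have "\<omega> i = w (x, v) i" if "i < v div L" for i
      proof (rule sep[OF \<omega> w(1) that], intro allI impI)
        fix i assume "i < v div L * L"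
        then have "i < v" by (meson div_times_less_eq_dividend order_less_le_trans)
        then have "dist ((f ^^ i) x) ((f ^^ i) (z \<omega>)) < \<theta>" "dist ((f ^^ i) x) ((f ^^ i) (z (w (x, v)))) < \<theta>"
          using xv(2) w(2) \<open>v > 0\<close> by (auto simp: bowen_ball_def bowen_dist_less_iff)
        then show "dist ((f ^^ i) (z \<omega>)) ((f ^^ i) (z (w (x, v)))) < 2 * \<theta>"
          using dist_triangle_less_add[of "(f ^^ i) (z \<omega>)" "(f ^^ i) x" \<theta> "(f ^^ i) (z (w (x, v)))" \<theta>]
          by (simp add: dist_commute)
      qed
      then show ?thesis using xv(1) by (intro bexI[of _ "(x, v)"]) auto
    qed
    \<comment> \<open>rounding \<open>v\<close> down to a multiple of \<open>L\<close> costs at most the factor \<open>c = exp (- t L)\<close>\<close>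
    have weight: "c * (1 / real (card E)) ^ (snd c' div L) \<le> exp (- t' * real (snd c'))" for c' :: "'a \<times> nat"
    proof -
      define v where "v = snd c'"
      have "real v \<le> real ((v div L) * L + L)"
        using \<open>L > 0\<close> by (metis add_le_cancel_left div_mult_mod_eq less_imp_le mod_less_divisor of_nat_le_iff)
      then have v: "t * real v \<le> t * (real (v div L) * real L + real L)"
        using t(1) by (intro mult_left_mono) auto
      have "(1 / real (card E)) ^ (v div L) \<le> (1 / exp (t * real L)) ^ (v div L)"
        using t(2) by (intro power_mono divide_left_mono) (auto intro: mult_pos_pos order_less_le_trans[OF exp_gt_zero])
      also have "\<dots> = exp (- t * (real (v div L) * real L))"
        by (simp add: exp_minus inverse_eq_divide power_one_over exp_of_nat_mult[symmetric] algebra_simps)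
      finally have "c * (1 / real (card E)) ^ (v div L) \<le> c * exp (- t * (real (v div L) * real L))"
        by (simp add: c_def)
      also have "\<dots> = exp (- t * (real (v div L) * real L + real L))"
        unfolding c_def by (simp add: exp_add[symmetric] algebra_simps)
      also have "\<dots> \<le> exp (- t * real v)" using v by simp
      also have "\<dots> \<le> exp (- t' * real v)" using \<open>t' < t\<close> by (simp add: mult_right_mono)
      finally show ?thesis by (simp add: v_def)
    qed
    have "countable C" using C by (simp add: bowen_covers_def)
    then have "1 \<le> (\<Sum>\<^sub>\<infinity>c\<in>C. ennreal ((1 / real (card E)) ^ (snd c div L)))"
      using cov by (intro cylinder_cover_weight_ge_1[OF E])
    then have "ennreal c * 1 \<le> ennreal c * (\<Sum>\<^sub>\<infinity>c\<in>C. ennreal ((1 / real (card E)) ^ (snd c div L)))"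
      by (rule mult_left_mono) simp
    also have "\<dots> = (SUP F\<in>{F. finite F \<and> F \<subseteq> C}. ennreal c * (\<Sum>c\<in>F. ennreal ((1 / real (card E)) ^ (snd c div L))))"
      by (subst nonneg_infsum_complete) (auto simp: SUP_mult_left_ennreal)
    also have "\<dots> \<le> (SUP F\<in>{F. finite F \<and> F \<subseteq> C}. \<Sum>c\<in>F. ennreal (exp (- t' * real (snd c))))"
    proof (intro SUP_mono bexI)
      fix F :: "('a \<times> nat) set"
      have "ennreal c * (\<Sum>c\<in>F. ennreal ((1 / real (card E)) ^ (snd c div L))) 
          = (\<Sum>c'\<in>F. ennreal (c * (1 / real (card E)) ^ (snd c' div L)))"
        by (simp add: sum_distrib_left ennreal_mult'[symmetric] c_def del: sum_ennreal)
      also have "\<dots> \<le> (\<Sum>c\<in>F. ennreal (exp (- t' * real (snd c))))"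
        by (intro sum_mono ennreal_leI weight)
      finally show "ennreal c * (\<Sum>c\<in>F. ennreal ((1 / real (card E)) ^ (snd c div L))) 
          \<le> (\<Sum>c\<in>F. ennreal (exp (- t' * real (snd c))))" .
    qed auto
    also have "\<dots> = (\<Sum>\<^sub>\<infinity>c\<in>C. ennreal (exp (- t' * real (snd c))))"
      by (subst nonneg_infsum_complete) auto
    finally show "ennreal c \<le> (\<Sum>\<^sub>\<infinity>(x, v)\<in>C. ennreal (exp (- t' * real v)))"
      by (simp add: case_prod_unfold)
  qed
  then show "\<exists>c>0. \<exists>n. c \<le> bowen_outer f Z t' n \<theta>" 
    by (intro exI[of _ "ennreal c"] conjI exI[of _ 1]) (auto simp: c_def)
qed

text \<open>A nonempty set traces the full shift on a single symbol.\<close>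

lemma bowen_entropy_at_nonneg:
  assumes "Z \<noteq> {}"
  shows "0 \<le> bowen_entropy_at f Z \<theta>"
proof -
  obtain x where "x \<in> Z" using assms by auto
  then have "ereal 0 \<le> bowen_entropy_at f Z \<theta>"
    by (intro entropy_distribution_principle[of "{()}" 1 0 "\<lambda>_. x"]) auto
  then show ?thesis by (simp add: zero_ereal_def)
qed

section \<open>Separated sets from entropy\<close>

text \<open>A cover by Bowen balls of one common length \<open>n\<close> is among those that define the
  entropy. Fewer than \<open>exp (n t)\<close> balls have total weight below \<open>exp (- (t' - t) n)\<close> at any
  exponent \<open>t' > t\<close>, and if this happened for infinitely many \<open>n\<close>, the limit at \<open>t'\<close> would vanish.\<close>

lemma covering_number_ge:
  fixes f :: "'a::metric_space \<Rightarrow> 'a"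
  assumes "ereal t < bowen_entropy_at f Y s"
  shows "eventually (\<lambda>n. \<forall>F. finite F \<and> Y \<subseteq> (\<Union>x\<in>F. bowen_ball f n x s) \<longrightarrow> exp (real n * t) \<le> real (card F)) sequentially"
proof (rule ccontr)
  obtain t' where t': "t < t'" "ereal t' < bowen_entropy_at f Y s"
    using ereal_dense2[OF assms] by auto
  assume "\<not> ?thesis"
  then have often: "\<exists>n\<ge>m. \<exists>F. finite F \<and> Y \<subseteq> (\<Union>x\<in>F. bowen_ball f n x s) \<and> real (card F) < exp (real n * t)" for m
    unfolding eventually_sequentially by (metis not_le)
  have "bowen_outer f Y t' m s \<le> ennreal (exp (- (t' - t) * real k))" for m k
  proof -
    obtain n F where n: "n \<ge> max m k" and F: "finite F" "Y \<subseteq> (\<Union>x\<in>F. bowen_ball f n x s)" 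
      "real (card F) < exp (real n * t)" using often by blast
    have "F \<times> {n} \<in> bowen_covers f Y m s"
      using F n by (auto simp: bowen_covers_def countable_finite)
    then have "bowen_outer f Y t' m s \<le> (\<Sum>\<^sub>\<infinity>(x, v)\<in>F \<times> {n}. ennreal (exp (- t' * real v)))"
      unfolding bowen_outer_def by (rule INF_lower)
    also have "\<dots> = (\<Sum>(x, v)\<in>F \<times> {n}. ennreal (exp (- t' * real v)))" using F(1) by simp
    also have "\<dots> = (\<Sum>c\<in>F \<times> {n}. ennreal (exp (- t' * real n)))" by (intro sum.cong) auto
    also have "\<dots> = ennreal (real (card F) * exp (- t' * real n))"
      by (simp add: card_cartesian_product ennreal_mult ennreal_of_nat_eq_real_of_nat)
    also have "\<dots> \<le> ennreal (exp (- (t' - t) * real k))"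
    proof (rule ennreal_leI)
      have "real (card F) * exp (- t' * real n) \<le> exp (real n * t) * exp (- t' * real n)"
        using F(3) by (intro mult_right_mono) auto
      also have "\<dots> = exp (- (t' - t) * real n)" by (simp add: exp_add[symmetric] algebra_simps)
      also have "\<dots> \<le> exp (- (t' - t) * real k)"
        using n t'(1) by (simp add: mult_left_mono)
      finally show "real (card F) * exp (- t' * real n) \<le> exp (- (t' - t) * real k)" .
    qed
    finally show ?thesis .
  qed
  moreover have "(\<lambda>k. ennreal (exp (- (t' - t) * real k))) \<longlonglongrightarrow> ennreal 0"
  proof (rule tendsto_ennrealI)
    have "(\<lambda>k. (exp (- (t' - t))) ^ k) \<longlonglongrightarrow> 0" using t'(1) by (intro LIMSEQ_realpow_zero) auto
    then show "(\<lambda>k. exp (- (t' - t) * real k)) \<longlonglongrightarrow> 0" 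
      by (simp add: exp_of_nat_mult[symmetric] mult.commute)
  qed
  ultimately have "bowen_outer f Y t' m s \<le> ennreal 0" for m
    by (intro LIMSEQ_le_const[where X = "\<lambda>k. ennreal (exp (- (t' - t) * real k))"]) auto
  then have "bowen_outer_lim f Y t' s = 0" by (simp add: bowen_outer_lim_eq_SUP)
  then have "bowen_entropy_at f Y s \<le> ereal t'"
    unfolding bowen_entropy_at_def by (intro Inf_lower) auto
  then show False using t'(2) by simp
qed

text \<open>Points are added greedily: fewer than \<open>K\<close> of them leave some point of \<open>Y\<close>
  uncovered.\<close>

lemma separated_subset_if_not_covered:
  assumes "n > 0" "s > 0"
    and cover: "\<And>F. finite F \<Longrightarrow> Y \<subseteq> (\<Union>x\<in>F. bowen_ball f n x s) \<Longrightarrow> K \<le> card F"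
  obtains E where "E \<subseteq> Y" "finite E" "card E = K"
    "\<And>x y. x \<in> E \<Longrightarrow> y \<in> E \<Longrightarrow> bowen_dist f n x y < s \<Longrightarrow> x = y"
proof -
  have sym: "bowen_dist f n x y = bowen_dist f n y x" for x y
    by (simp add: bowen_dist_def dist_commute)
  have "\<exists>E\<subseteq>Y. finite E \<and> card E = k \<and> (\<forall>x\<in>E. \<forall>y\<in>E. bowen_dist f n x y < s \<longrightarrow> x = y)" if "k \<le> K" for k
    using that
  proof (induction k)
    case (Suc k)
    then obtain E where E: "E \<subseteq> Y" "finite E" "card E = k" 
      "\<forall>x\<in>E. \<forall>y\<in>E. bowen_dist f n x y < s \<longrightarrow> x = y" by auto
    then obtain y where y: "y \<in> Y" "\<forall>x\<in>E. \<not> bowen_dist f n x y < s"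
      using cover[of E] Suc.prems unfolding bowen_ball_def by fastforce
    show ?case
    proof (cases "y \<in> E")
      case False
      then show ?thesis
        using E y
      proof (intro exI[of _ "insert y E"] conjI ballI impI)
        fix a b assume "a \<in> insert y E" "b \<in> insert y E" "bowen_dist f n a b < s"
        then show "a = b" using E(4) y(2) sym[of a b] by auto
      qed auto
    next
      case True
      then have "\<not> bowen_dist f n y y < s" using y(2) by blast
      then show ?thesis using assms(1,2) by (simp add: bowen_dist_less_iff)
    qed
  qed (auto intro: exI[of _ "{}"])
  from this[of K] show ?thesis using that by blast
qed

section \<open>Rescaling in the metric mean dimension\<close>

text \<open>The ratio \<open>ln (3 \<theta>) / ln \<theta>\<close> increases to 1 as \<open>\<theta>\<close> decreases to 0, so it is eventually above any
  \<open>c < 1\<close>. The threshold in \<open>\<theta>\<close> must not depend on \<open>h\<close>, which is later instantiated with a function of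
  \<open>\<theta>\<close>.\<close>

lemma scaled_mdim_quotient_ge:
  assumes "0 < c" "c < 1"
  shows "eventually (\<lambda>\<theta>. \<forall>h::ereal. h \<ge> 0 \<longrightarrow> ereal c * (h / ereal (- ln (3 * \<theta>))) \<le> h / ereal (- ln \<theta>)) (at_right 0)"
proof -
  \<comment> \<open>at \<open>\<theta> = q\<close> one has \<open>c ln \<theta> = ln (3 \<theta>)\<close>\<close>
  define q where "q = 3 powr (- (1 / (1 - c)))"
  have q: "0 < q" "q < 1/3"
  proof -
    show "0 < q" by (simp add: q_def)
    have "1 / (1 - c) > 1" using assms by (simp add: field_simps)
    then have "q < 3 powr (- 1)" unfolding q_def by (intro powr_less_mono) auto
    then show "q < 1/3" by (simp add: powr_minus)
  qed
  have "ereal c * (h / ereal (- ln (3 * \<theta>))) \<le> h / ereal (- ln \<theta>)"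
    if \<theta>: "0 < \<theta>" "\<theta> < q" and "h \<ge> 0" for \<theta> and h :: ereal
  proof -
    have ln3: "ln (3 * \<theta>) = ln 3 + ln \<theta>" using \<theta> by (simp add: ln_mult)
    have "3 * \<theta> < 1" using \<theta> q by simp
    then have neg: "ln (3 * \<theta>) < 0" using \<theta> by simp
    have "ln \<theta> < ln q" using \<theta> by (simp add: q)
    also have "ln q = - (ln 3 / (1 - c))" by (simp add: q_def ln_powr)
    finally have "(1 - c) * ln \<theta> < - ln 3" using assms by (simp add: field_simps)
    then have "c * (- ln \<theta>) \<le> - ln (3 * \<theta>)" unfolding ln3 left_diff_distrib by simp
    then have le: "c / (- ln (3 * \<theta>)) \<le> 1 / (- ln \<theta>)"
      using neg \<theta> q assms by (simp add: field_simps)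
    have "ereal c * (h / ereal (- ln (3 * \<theta>))) = h * ereal (c / (- ln (3 * \<theta>)))"
      using neg by (cases h) (auto simp: field_simps)
    also have "\<dots> \<le> h * ereal (1 / (- ln \<theta>))"
      using le \<open>h \<ge> 0\<close> by (intro ereal_mult_left_mono) auto
    also have "\<dots> = h / ereal (- ln \<theta>)"
      using \<theta> q by (cases h) (auto simp: field_simps)
    finally show ?thesis .
  qed
  then show ?thesis unfolding eventually_at_right_field using q(1) by blast
qed

lemma Limsup_at_right_0_scale:
  fixes g :: "real \<Rightarrow> ereal"
  shows "Limsup (at_right 0) (\<lambda>\<theta>. g (3 * \<theta>)) = Limsup (at_right 0) g"
    and "Liminf (at_right 0) (\<lambda>\<theta>. g (3 * \<theta>)) = Liminf (at_right 0) g"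
proof -
  have "filtermap (times 3) (at_right 0) = at_right (0::real)"
    using filtermap_times_pos_at_right[of 3 "0::real"] by simp
  then show "Limsup (at_right 0) (\<lambda>\<theta>. g (3 * \<theta>)) = Limsup (at_right 0) g"
    and "Liminf (at_right 0) (\<lambda>\<theta>. g (3 * \<theta>)) = Liminf (at_right 0) g"
    using Limsup_filtermap_eq[of "times 3" "at_right 0" g] Liminf_filtermap_eq[of "times 3" "at_right 0" g]
    by (simp_all add: inj_on_def)
qed

section \<open>The entropy estimate and the theorem\<close>

lemma invariant_measure_orbit_sum_ge:
  fixes f :: "'a::metric_space \<Rightarrow> 'a" and \<Phi> :: "'a \<Rightarrow> real"
  assumes cpt: "compact (UNIV :: 'a set)" and cont_\<Phi>: "continuous_on UNIV \<Phi>"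
    and \<mu>: "\<mu> \<in> ergodic_measures f Y"
  shows "\<exists>x\<in>Y. real n * (\<integral>x. \<Phi> x \<partial>\<mu>) \<le> (\<Sum>i<n. \<Phi> ((f ^^ i) x))"
proof (rule ccontr)
  assume "\<not> ?thesis"
  then have less: "(\<Sum>i<n. \<Phi> ((f ^^ i) x)) < real n * (\<integral>x. \<Phi> x \<partial>\<mu>)" if "x \<in> Y" for x
    using that by (meson not_le)
  interpret prob_space \<mu> using \<mu> by (simp add: ergodic_measures_def)
  have space: "space \<mu> = Y" and sets: "sets \<mu> = sets (restrict_space borel Y)"
    and f: "f \<in> measurable \<mu> \<mu>" and inv: "distr \<mu> \<mu> f = \<mu>"
    using \<mu> by (auto simp: ergodic_measures_def)
  have iter: "(f ^^ i) \<in> measurable \<mu> \<mu>" for i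
    by (induction i) (auto simp: id_def o_def intro: measurable_compose[OF _ f])
  have "\<Phi> \<in> borel_measurable (restrict_space borel Y)"
    using borel_measurable_continuous_onI[OF cont_\<Phi>] by (rule measurable_restrict_space1)
  then have \<Phi>: "\<Phi> \<in> borel_measurable \<mu>"
    using measurable_cong_sets[OF sets refl] by blast
  have "bounded (range \<Phi>)" using compact_continuous_image[OF cont_\<Phi> cpt] compact_imp_bounded by blast
  then obtain B where B: "\<And>x. \<bar>\<Phi> x\<bar> \<le> B" by (auto simp: bounded_iff)
  have int: "integrable \<mu> (\<lambda>x. \<Phi> ((f ^^ i) x))" for i
    using B measurable_compose[OF iter \<Phi>] by (intro integrable_const_bound[of _ B]) auto
  have eq: "(\<integral>x. \<Phi> ((f ^^ i) x) \<partial>\<mu>) = (\<integral>x. \<Phi> x \<partial>\<mu>)" for i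
  proof (induction i)
    case (Suc i)
    have "(\<integral>x. \<Phi> ((f ^^ i) x) \<partial>distr \<mu> \<mu> f) = (\<integral>x. \<Phi> ((f ^^ i) (f x)) \<partial>\<mu>)"
      using f measurable_compose[OF iter \<Phi>] by (rule integral_distr)
    then show ?case using Suc by (simp add: inv funpow_swap1)
  qed simp
  have "(\<integral>x. (\<Sum>i<n. \<Phi> ((f ^^ i) x)) \<partial>\<mu>) < real n * (\<integral>x. \<Phi> x \<partial>\<mu>)"
    using less int by (intro expectation_less) (auto simp: space)
  moreover have "(\<integral>x. (\<Sum>i<n. \<Phi> ((f ^^ i) x)) \<partial>\<mu>) = real n * (\<integral>x. \<Phi> x \<partial>\<mu>)"
    using int by (subst Bochner_Integration.integral_sum) (auto simp: eq)
  ultimately show False by simp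
qed

text \<open>The scale \<open>3 \<theta>\<close> on \<open>Y\<close> is spent as follows: two points in a common Bowen ball of radius
  \<open>\<theta>\<close> differ by less than \<open>2 \<theta>\<close>, and each of them follows its segment with error at most
  \<open>\<theta> / 2\<close>.\<close>

lemma irregular_entropy_at_ge:
  fixes f :: "'a::metric_space \<Rightarrow> 'a" and \<Phi> :: "'a \<Rightarrow> real"
  assumes cpt: "compact (UNIV :: 'a set)" and cont: "continuous_on UNIV f"
    and shad: "shadowing_property f"
    and p: "p \<in> Y" and rel: "\<And>u. u \<in> Y \<Longrightarrow> chain_related f p u" and inv: "f ` Y \<subseteq> Y"
    and cont_\<Phi>: "continuous_on UNIV \<Phi>"
    and high: "\<And>n. \<exists>x\<in>Y. real n * I1 \<le> (\<Sum>i<n. \<Phi> ((f ^^ i) x))"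
    and low: "\<And>n. \<exists>x\<in>Y. (\<Sum>i<n. \<Phi> ((f ^^ i) x)) \<le> real n * I2" 
    and "I2 < I1" "\<epsilon> > 0"
  defines "Z \<equiv> irregular_set \<Phi> f \<inter> set_nbhd Y \<epsilon> \<inter> chain_recurrent_set f"
  shows "Z \<noteq> {}" "\<And>\<theta>. \<theta> > 0 \<Longrightarrow> bowen_entropy_at f Y (3 * \<theta>) \<le> bowen_entropy_at f Z \<theta>"
proof -
  have nbhd: "irregular_set \<Phi> f \<inter> chain_recurrent_set f \<inter> cball p e \<subseteq> Z" if "e < \<epsilon>" for e
  proof -
    have "cball p e \<subseteq> set_nbhd Y \<epsilon>" using that p unfolding set_nbhd_def by (intro subsetI UN_I[of p]) auto
    then show ?thesis by (auto simp: Z_def)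
  qed
  show "Z \<noteq> {}"
  proof -
    have half: "\<epsilon> / 2 > 0" using \<open>\<epsilon> > 0\<close> by simp
    obtain T where "T > 0" and T: "\<And>n0. \<exists>M>n0. \<forall>E. E \<subseteq> Y \<longrightarrow> finite E \<longrightarrow> (\<exists>E' \<tau> L. E' \<subseteq> E \<and> card E \<le> T\<^sup>2 * card E' \<and>
        \<tau> + 1 * M \<le> L \<and> L \<le> (1 + 1) * M + 2 * T \<and>
        traces_all f (irregular_set \<Phi> f \<inter> chain_recurrent_set f \<inter> cball p (\<epsilon> / 2)) E' (1 * M) L \<tau> (\<epsilon> / 2))"
      using irregular_points_following_free_orbit_segments[OF cpt cont shad rel inv cont_\<Phi> high low \<open>I2 < I1\<close> half zero_less_one]
      by blast
    \<comment> \<open>for nonemptiness a single free segment is enough\<close>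
    have "{p} \<subseteq> Y" "finite {p}" using p by auto
    obtain M where "\<forall>E. E \<subseteq> Y \<longrightarrow> finite E \<longrightarrow> (\<exists>E' \<tau> L. E' \<subseteq> E \<and> card E \<le> T\<^sup>2 * card E' \<and>
        \<tau> + 1 * M \<le> L \<and> L \<le> (1 + 1) * M + 2 * T \<and>
        traces_all f (irregular_set \<Phi> f \<inter> chain_recurrent_set f \<inter> cball p (\<epsilon> / 2)) E' (1 * M) L \<tau> (\<epsilon> / 2))"
      using T by blast
    from this[rule_format, OF \<open>{p} \<subseteq> Y\<close> \<open>finite {p}\<close>]
    obtain E' n L \<tau> where E': "E' \<subseteq> {p}" "card {p} \<le> T\<^sup>2 * card E'"
      "traces_all f (irregular_set \<Phi> f \<inter> chain_recurrent_set f \<inter> cball p (\<epsilon> / 2)) E' n L \<tau> (\<epsilon> / 2)"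
      by blast
    have "E' = {p}" using E'(1,2) by (cases "E' = {}") auto
    then have "range (\<lambda>_::nat. p) \<subseteq> E'" by simp
    then have "irregular_set \<Phi> f \<inter> chain_recurrent_set f \<inter> cball p (\<epsilon> / 2) \<noteq> {}"
      using E'(3) unfolding traces_all_def by blast
    then show ?thesis using nbhd[of "\<epsilon> / 2"] \<open>\<epsilon> > 0\<close> by auto
  qed
  fix \<theta> :: real assume "\<theta> > 0"
  show "bowen_entropy_at f Y (3 * \<theta>) \<le> bowen_entropy_at f Z \<theta>"
  proof (rule ccontr)
    assume "\<not> ?thesis"
    then obtain t where t: "bowen_entropy_at f Z \<theta> < ereal t" "ereal t < bowen_entropy_at f Y (3 * \<theta>)"
      using ereal_dense2 by (meson not_le)
    then obtain t' where t': "t < t'" "ereal t' < bowen_entropy_at f Y (3 * \<theta>)"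
      using ereal_dense2[OF t(2)] by auto
    have "0 \<le> bowen_entropy_at f Z \<theta>" using \<open>Z \<noteq> {}\<close> by (rule bowen_entropy_at_nonneg)
    then have "ereal 0 < ereal t" using t(1) by (metis order_le_less_trans zero_ereal_def)
    then have "t > 0" by simp
    \<comment> \<open>a segment of length \<open>g M\<close> inside a block of length about \<open>(g + 1) M\<close> costs the factor \<open>g / (g + 1)\<close>\<close>
    obtain g :: nat where g: "real g * (t' - t) > t"
      using reals_Archimedean3[of "t' - t"] t'(1) by auto
    then have "g > 0" using \<open>t > 0\<close> by (cases g) auto
    define e where "e = min (\<epsilon> / 2) (\<theta> / 2)"
    have e: "e > 0" "e < \<epsilon>" "2 * e \<le> \<theta>" using \<open>\<epsilon> > 0\<close> \<open>\<theta> > 0\<close> by (auto simp: e_def)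
    obtain T where "T > 0" and T: "\<And>n0. \<exists>M>n0. \<forall>E. E \<subseteq> Y \<longrightarrow> finite E \<longrightarrow> (\<exists>E' \<tau> L. E' \<subseteq> E \<and> card E \<le> T\<^sup>2 * card E' \<and>
        \<tau> + g * M \<le> L \<and> L \<le> (g + 1) * M + 2 * T \<and>
        traces_all f (irregular_set \<Phi> f \<inter> chain_recurrent_set f \<inter> cball p e) E' (g * M) L \<tau> e)"
      using irregular_points_following_free_orbit_segments[OF cpt cont shad rel inv cont_\<Phi> high low \<open>I2 < I1\<close> e(1) \<open>g > 0\<close>]
      by blast
    obtain n1 where n1: "\<And>n F. n \<ge> n1 \<Longrightarrow> finite F \<Longrightarrow> Y \<subseteq> (\<Union>x\<in>F. bowen_ball f n x (3 * \<theta>)) \<Longrightarrow> exp (real n * t') \<le> real (card F)"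
      using covering_number_ge[OF t'(2)] unfolding eventually_sequentially by blast
    \<comment> \<open>the surplus per unit of \<open>M\<close> has to pay for the connecting pieces and for the pigeonhole factor \<open>T\<^sup>2\<close>\<close>
    obtain n2 :: nat where n2: "real n2 * (real g * t' - (real g + 1) * t) > 2 * ln (real T) + 2 * real T * t"
    proof -
      have "real g * t' - (real g + 1) * t > 0" using g by (simp add: algebra_simps)
      then show ?thesis using that reals_Archimedean3 by blast
    qed
    obtain M where M: "M > max n1 n2" and free: "\<And>E. E \<subseteq> Y \<Longrightarrow> finite E \<Longrightarrow> \<exists>E' \<tau> L. E' \<subseteq> E \<and> card E \<le> T\<^sup>2 * card E' \<and>
        \<tau> + g * M \<le> L \<and> L \<le> (g + 1) * M + 2 * T \<and>
        traces_all f (irregular_set \<Phi> f \<inter> chain_recurrent_set f \<inter> cball p e) E' (g * M) L \<tau> e"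
      using T[of "max n1 n2"] by blast
    define n where "n = g * M"
    have "n \<ge> M" using \<open>g > 0\<close> by (simp add: n_def)
    then have "n \<ge> n1" "n > 0" using M by auto
    define K where "K = nat \<lceil>exp (real n * t')\<rceil>"
    have K: "exp (real n * t') \<le> real K" by (simp add: K_def real_nat_ceiling_ge)
    have "K \<le> card F" if "finite F" "Y \<subseteq> (\<Union>x\<in>F. bowen_ball f n x (3 * \<theta>))" for F
      using n1[OF \<open>n \<ge> n1\<close> that] by (simp add: K_def nat_le_iff ceiling_le_iff)
    then obtain E where E: "E \<subseteq> Y" "finite E" "card E = K"
      and sep: "\<And>x y. x \<in> E \<Longrightarrow> y \<in> E \<Longrightarrow> bowen_dist f n x y < 3 * \<theta> \<Longrightarrow> x = y"
      using separated_subset_if_not_covered[OF \<open>n > 0\<close>, of "3 * \<theta>" Y f K] \<open>\<theta> > 0\<close> by auto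
    obtain E' \<tau> L where E': "E' \<subseteq> E" "card E \<le> T\<^sup>2 * card E'" and L: "\<tau> + n \<le> L" "L \<le> (g + 1) * M + 2 * T"
      and "traces_all f (irregular_set \<Phi> f \<inter> chain_recurrent_set f \<inter> cball p e) E' n L \<tau> e"
      using free[OF E(1,2)] unfolding n_def by blast
    then have "\<forall>\<omega>. range \<omega> \<subseteq> E' \<longrightarrow> (\<exists>z\<in>Z. \<forall>b. \<forall>i<n. dist ((f ^^ i) (\<omega> b)) ((f ^^ (b * L + \<tau> + i)) z) \<le> e)"
      using nbhd[OF e(2)] unfolding traces_all_def by blast
    then obtain z where z: "\<And>\<omega>. range \<omega> \<subseteq> E' \<Longrightarrow> z \<omega> \<in> Z"
      "\<And>\<omega> b i. range \<omega> \<subseteq> E' \<Longrightarrow> i < n \<Longrightarrow> dist ((f ^^ i) (\<omega> b)) ((f ^^ (b * L + \<tau> + i)) (z \<omega>)) \<le> e"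
      by metis
    have "ereal t \<le> bowen_entropy_at f Z \<theta>"
    proof (rule entropy_distribution_principle)
      show "finite E'" using E' E(2) finite_subset by blast
      show "L > 0" using L(1) \<open>n > 0\<close> by simp
      show "t \<ge> 0" using \<open>t > 0\<close> by simp
      show "exp (t * real L) \<le> real (card E')"
      proof -
        have "real L \<le> real ((g + 1) * M + 2 * T)" using L(2) by (simp only: of_nat_le_iff)
        then have "t * real L \<le> t * ((real g + 1) * real M + 2 * real T)"
          using \<open>t > 0\<close> by (intro mult_left_mono) (simp_all add: distrib_right)
        moreover have "real n2 * (real g * t' - (real g + 1) * t) \<le> real M * (real g * t' - (real g + 1) * t)"
          using M g by (intro mult_right_mono) (auto simp: algebra_simps)
        ultimately have "t * real L + 2 * ln (real T) \<le> real n * t'"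
          using n2 by (simp add: n_def algebra_simps)
        then have "exp (t * real L + 2 * ln (real T)) \<le> real K" using K by (meson exp_le_cancel_iff order_trans)
        also have "\<dots> \<le> real (T\<^sup>2 * card E')" using E(3) E'(2) by (simp only: of_nat_le_iff)
        also have "\<dots> = exp (2 * ln (real T)) * real (card E')"
          using \<open>T > 0\<close> by (simp add: exp_double)
        finally show ?thesis by (simp add: exp_add mult.commute)
      qed
      then show "E' \<noteq> {}" by (auto simp: not_le)
      show "z \<omega> \<in> Z" if "range \<omega> \<subseteq> E'" for \<omega>
        using z(1)[OF that] .
      fix \<omega> \<omega>' :: "nat \<Rightarrow> 'a" and k b :: nat
      assume \<omega>: "range \<omega> \<subseteq> E'" "range \<omega>' \<subseteq> E'" and "b < k"
        and close: "\<forall>i<k * L. dist ((f ^^ i) (z \<omega>)) ((f ^^ i) (z \<omega>')) < 2 * \<theta>"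
      have "dist ((f ^^ i) (\<omega> b)) ((f ^^ i) (\<omega>' b)) < 3 * \<theta>" if "i < n" for i
      proof -
        define m where "m = b * L + \<tau> + i"
        have "m < Suc b * L" using that L(1) by (simp add: m_def)
        also have "\<dots> \<le> k * L" using \<open>b < k\<close> by (intro mult_right_mono) auto
        finally have "dist ((f ^^ m) (z \<omega>)) ((f ^^ m) (z \<omega>')) < 2 * \<theta>" using close by blast
        moreover have "dist ((f ^^ i) (\<omega> b)) ((f ^^ m) (z \<omega>)) \<le> e" "dist ((f ^^ i) (\<omega>' b)) ((f ^^ m) (z \<omega>')) \<le> e"
          using z(2) \<omega> that by (simp_all add: m_def)
        ultimately show ?thesis
          using dist_triangle[of "(f ^^ i) (\<omega> b)" "(f ^^ i) (\<omega>' b)" "(f ^^ m) (z \<omega>)"]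
            dist_triangle2[of "(f ^^ m) (z \<omega>)" "(f ^^ i) (\<omega>' b)" "(f ^^ m) (z \<omega>')"] e(3) by linarith
      qed
      then have "bowen_dist f n (\<omega> b) (\<omega>' b) < 3 * \<theta>" using \<open>n > 0\<close> by (simp add: bowen_dist_less_iff)
      then show "\<omega> b = \<omega>' b" using sep \<omega> E'(1) by blast
    qed
    then show False using t(1) by simp
  qed
qed

lemma mdim_mono_under_rescaling:
  assumes "Y \<noteq> {}" and le: "\<And>\<theta>. \<theta> > 0 \<Longrightarrow> bowen_entropy_at f Y (3 * \<theta>) \<le> bowen_entropy_at f Z \<theta>"
  shows "upper_mdim f Y \<le> upper_mdim f Z" "lower_mdim f Y \<le> lower_mdim f Z"
proof -
  define u where "u = (\<lambda>\<theta>. bowen_entropy_at f Y \<theta> / ereal (- ln \<theta>))"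
  define v where "v = (\<lambda>\<theta>. bowen_entropy_at f Z \<theta> / ereal (- ln \<theta>))"
  have small: "eventually (\<lambda>\<theta>::real. 0 < \<theta> \<and> \<theta> < 1/3) (at_right 0)"
    unfolding eventually_at_right_field by (rule exI[of _ "1/3"]) simp
  have ev: "eventually (\<lambda>\<theta>. ereal c * u (3 * \<theta>) \<le> v \<theta>) (at_right 0)" if c: "0 < c" "c < 1" for c
    using small scaled_mdim_quotient_ge[OF c]
  proof eventually_elim
    case (elim \<theta>)
    have "ereal c * u (3 * \<theta>) \<le> bowen_entropy_at f Y (3 * \<theta>) / ereal (- ln \<theta>)"
      using elim(2) bowen_entropy_at_nonneg[OF assms(1)] by (simp add: u_def)
    also have "\<dots> \<le> v \<theta>"
      unfolding v_def using elim(1) by (intro ereal_divide_right_mono le) auto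
    finally show ?case .
  qed
  have v0: "eventually (\<lambda>\<theta>. 0 \<le> v \<theta>) (at_right 0)"
    using small
  proof eventually_elim
    case (elim \<theta>)
    have "0 \<le> bowen_entropy_at f Z \<theta>"
      using bowen_entropy_at_nonneg[OF assms(1)] le[of \<theta>] elim order_trans by blast
    then have "0 / ereal (- ln \<theta>) \<le> v \<theta>"
      using elim unfolding v_def by (intro ereal_divide_right_mono) auto
    then show ?case by simp
  qed
  show "upper_mdim f Y \<le> upper_mdim f Z"
  proof (rule ereal_le_mult_one_interval)
    have "0 \<le> Liminf (at_right 0) v" using v0 by (intro Liminf_bounded)
    also have "\<dots> \<le> upper_mdim f Z" unfolding upper_mdim_def v_def by (intro Liminf_le_Limsup) simp
    finally show "upper_mdim f Z \<noteq> - \<infinity>" by auto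
    fix c :: ereal assume "0 < c" "c < 1"
    then obtain r where r: "c = ereal r" "0 < r" "r < 1" by (cases c) auto
    have "c * upper_mdim f Y = Limsup (at_right 0) (\<lambda>\<theta>. ereal r * u (3 * \<theta>))"
      using r Limsup_at_right_0_scale(1)[of u]
      by (subst Limsup_ereal_mult_left) (auto simp: upper_mdim_def u_def)
    also have "\<dots> \<le> upper_mdim f Z"
      unfolding upper_mdim_def using ev[OF r(2,3)] by (intro Limsup_mono) (simp add: v_def)
    finally show "c * upper_mdim f Y \<le> upper_mdim f Z" .
  qed
  show "lower_mdim f Y \<le> lower_mdim f Z"
  proof (rule ereal_le_mult_one_interval)
    have "0 \<le> lower_mdim f Z" using v0 unfolding lower_mdim_def v_def by (intro Liminf_bounded)
    then show "lower_mdim f Z \<noteq> - \<infinity>" by auto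
    fix c :: ereal assume "0 < c" "c < 1"
    then obtain r where r: "c = ereal r" "0 < r" "r < 1" by (cases c) auto
    have "c * lower_mdim f Y = Liminf (at_right 0) (\<lambda>\<theta>. ereal r * u (3 * \<theta>))"
      using r Limsup_at_right_0_scale(2)[of u]
      by (subst Liminf_ereal_mult_left) (auto simp: lower_mdim_def u_def)
    also have "\<dots> \<le> lower_mdim f Z"
      unfolding lower_mdim_def using ev[OF r(2,3)] by (intro Liminf_mono) (simp add: v_def)
    finally show "c * lower_mdim f Y \<le> lower_mdim f Z" .
  qed
qed

lemma bowen_entropy_mono_under_rescaling:
  assumes le: "\<And>\<theta>. \<theta> > 0 \<Longrightarrow> bowen_entropy_at f Y (3 * \<theta>) \<le> bowen_entropy_at f Z \<theta>"
  shows "bowen_entropy f Y \<le> bowen_entropy f Z"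
  unfolding bowen_entropy_eq_SUP
proof (rule SUP_mono)
  fix \<theta> :: real assume "\<theta> \<in> {0<..}"
  then show "\<exists>r\<in>{0<..}. bowen_entropy_at f Y \<theta> \<le> bowen_entropy_at f Z r"
    using le[of "\<theta> / 3"] by (intro bexI[of _ "\<theta> / 3"]) auto
qed

theorem theorem1p2:
  fixes f :: "'a::metric_space \<Rightarrow> 'a"
    and \<Phi> :: "'a \<Rightarrow> real"
    and Y :: "'a set"
    and \<mu>1 \<mu>2 :: "'a measure"
  assumes "compact (UNIV :: 'a set)"
    and "continuous_on UNIV f"
    and "shadowing_property f"
    and "Y \<in> chain_recurrent_classes f"
    and "continuous_on UNIV \<Phi>"
    and "\<mu>1 \<in> ergodic_measures f Y"
    and "\<mu>2 \<in> ergodic_measures f Y"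
    and "(\<integral>x. \<Phi> x \<partial>\<mu>1) \<noteq> (\<integral>x. \<Phi> x \<partial>\<mu>2)"
  shows "\<forall>\<epsilon>>0. let Z = irregular_set \<Phi> f \<inter> set_nbhd Y \<epsilon> \<inter> chain_recurrent_set f in
           Z \<noteq> {} \<and>
           bowen_entropy f Z \<ge> bowen_entropy f Y \<and>
           upper_mdim f Z \<ge> upper_mdim f Y \<and>
           lower_mdim f Z \<ge> lower_mdim f Y"
proof (intro allI impI)
  fix \<epsilon> :: real assume "\<epsilon> > 0"
  obtain p where p: "p \<in> Y" and rel: "\<And>u. u \<in> Y \<Longrightarrow> chain_related f p u"
    using chain_recurrent_class_base_point[OF assms(4)] by blast
  have "f \<in> measurable \<mu>1 \<mu>1" "space \<mu>1 = Y" using assms(6) by (auto simp: ergodic_measures_def)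
  then have inv: "f ` Y \<subseteq> Y" using measurable_space[of f \<mu>1 \<mu>1] by auto
  have high: "\<exists>x\<in>Y. real n * (\<integral>x. \<Phi> x \<partial>\<mu>) \<le> (\<Sum>i<n. \<Phi> ((f ^^ i) x))" 
    if "\<mu> \<in> ergodic_measures f Y" for n \<mu>
    using invariant_measure_orbit_sum_ge[OF assms(1,5) that] .
  have low: "\<exists>x\<in>Y. (\<Sum>i<n. \<Phi> ((f ^^ i) x)) \<le> real n * (\<integral>x. \<Phi> x \<partial>\<mu>)"
    if "\<mu> \<in> ergodic_measures f Y" for n \<mu>
    using invariant_measure_orbit_sum_ge[OF assms(1) continuous_on_minus[OF assms(5)] that, of n]
    by (simp add: sum_negf)
  obtain \<mu> \<nu> where \<mu>\<nu>: "\<mu> \<in> ergodic_measures f Y" "\<nu> \<in> ergodic_measures f Y"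
    and less: "(\<integral>x. \<Phi> x \<partial>\<nu>) < (\<integral>x. \<Phi> x \<partial>\<mu>)"
    using assms(6-8) by (meson linorder_neqE_linordered_idom)
  let ?Z = "irregular_set \<Phi> f \<inter> set_nbhd Y \<epsilon> \<inter> chain_recurrent_set f"
  note Z = irregular_entropy_at_ge[OF assms(1-3) p rel inv assms(5) high[OF \<mu>\<nu>(1)] low[OF \<mu>\<nu>(2)] less \<open>\<epsilon> > 0\<close>]
  have "Y \<noteq> {}" using p by blast
  show "let Z = ?Z in Z \<noteq> {} \<and> bowen_entropy f Z \<ge> bowen_entropy f Y \<and>
           upper_mdim f Z \<ge> upper_mdim f Y \<and> lower_mdim f Z \<ge> lower_mdim f Y"
    unfolding Let_def
    using Z(1) bowen_entropy_mono_under_rescaling[OF Z(2)] mdim_mono_under_rescaling[OF \<open>Y \<noteq> {}\<close> Z(2)] by blast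
qed

end
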